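(* Let $M^5\subset\mathbb{C}^4$ be a connected $5$-dimensional CR-generic submanifold belonging to the General Class $\mathsf{III}_1$, of smoothness $\mathcal{C}^\kappa$ with $\kappa\geqslant 3$, or $\mathcal{C}^\infty$, or $\mathcal{C}^\omega$, with its biholomorphically invariant $(1,0)$ CR bundle $T^{1,0}M\subset\mathbb{C}\otimes_{\mathbb{R}}TM$. For any choice of local vector field generator $\mathcal{L}$ of $T^{1,0}M$, the associated fields $$\big\{\mathcal{L},\ \overline{\mathcal{L}},\ \mathcal{T},\ \mathcal{S},\ \overline{\mathcal{S}}\big\},\qquad \mathcal{T}:=\sqrt{-1}\,[\mathcal{L},\overline{\mathcal{L}}],\quad \mathcal{S}:=[\mathcal{L},\mathcal{T}],\quad \overline{\mathcal{S}}=[\overline{\mathcal{L}},\mathcal{T}],$$ form a local frame for $\mathbb{C}\otimes_{\mathbb{R}}TM$, and these frames perform a reduction of the full $\mathsf{GL}_5(\mathbb{C})$-structure of $\mathbb{C}\otimes_{\mathbb{R}}TM$ to the subgroup of real dimension $10$ $$\mathsf{G}_{\mathsf{III}_1}^{\mathsf{initial}}:=\left\{\begin{pmatrix}\mathsf{a}&0&0&0&0\\0&\overline{\mathsf{a}}&0&0&0\\ \mathsf{b}&\overline{\mathsf{b}}&\mathsf{a}\overline{\mathsf{a}}&0&0\\ \mathsf{e}&\mathsf{d}&\mathsf{c}&\mathsf{a}\mathsf{a}\overline{\mathsf{a}}&0\\ \overline{\mathsf{d}}&\overline{\mathsf{e}}&\overline{\mathsf{c}}&0&\mathsf{a}\overline{\mathsf{a}}\overline{\mathsf{a}}\end{pmatrix}:\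 \mathsf{a}\in\mathbb{C}\setminus\{0\},\ \mathsf{b},\mathsf{c},\mathsf{d},\mathsf{e}\in\mathbb{C}\right\}\subset\mathsf{GL}_5(\mathbb{C}).$$
   Context: A real submanifold $M\subset\mathbb{C}^n$ is CR-generic if $TM+J\,TM=T\mathbb{C}^n|_M$, $J$ being the complex structure. $T^{1,0}M\subset\mathbb{C}\otimes_{\mathbb{R}}TM$ is the bundle of $(1,0)$ vectors tangent to $M$ and $T^{0,1}M=\overline{T^{1,0}M}$. For CR-generic $M^5\subset\mathbb{C}^4$, $T^{1,0}M$ has complex rank $1$; a local generator $\mathcal{L}$ is a nowhere vanishing local section, taken of the natural smoothness of the bundle ($\mathcal{C}^{\kappa-1}$, resp. $\mathcal{C}^\infty$, $\mathcal{C}^\omega$). General Class $\mathsf{III}_1$: $M^5\subset\mathbb{C}^4$ belongs to it if $\mathbb{C}\otimes_{\mathbb{R}}TM=T^{1,0}M+T^{0,1}M+[T^{1,0}M,T^{0,1}M]+[T^{1,0}M,[T^{1,0}M,T^{0,1}M]]+[T^{0,1}M,[T^{1,0}M,T^{0,1}M]]$, i.e. for any local generator $\mathcal{L}$ of $T^{1,0}M$, the vectors $\mathcal{L},\overline{\mathcal{L}},[\mathcal{L},\overline{\mathcal{L}}],[\mathcal{L},[\mathcal{L},\overline{\mathcal{L}}]],[\overline{\mathcal{L}},[\mathcal{L},\overline{\mathcal{L}}]]$ have complex rank $5$ at every point where $\mathcal{L}$ is defined. "These frames perform a reduction of the full $\mathsf{GL}$-structure to a subgroup $\mathsf{G}$"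 means: $\mathsf{G}$ is a closed subgroup of the general linear group, and for any two local generators defined on a common open subset $V\subset M$, the two associated frames, written as column vectors, are related at each point of $V$ by left multiplication by a matrix belonging to $\mathsf{G}$ (with entries functions on $V$). *)

theory Defs
  imports "HOL-Analysis.Analysis" "HOL-Algebra.Group"
begin

text \<open>Regularity classes: \<open>Ck k\<close> is $C^k$, \<open>Cinf\<close> is $C^\infty$, \<open>Comega\<close> is
  real-analytic. \<open>drop_reg r k\<close> is the class left after losing \<open>k\<close> derivatives.\<close>

datatype regularity = Ck nat | Cinf | Comega

fun drop_reg :: "regularity \<Rightarrow> nat \<Rightarrow> regularity" where
  "drop_reg (Ck n) k = Ck (n - k)"
| "drop_reg Cinf k = Cinf"
| "drop_reg Comega k = Comega"

primrec Ck_on :: "nat \<Rightarrow> ('a::real_normed_vector \<Rightarrow> 'b::real_normed_vector) \<Rightarrow> 'a set \<Rightarrow> bool" where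
  "Ck_on 0 f U \<longleftrightarrow> continuous_on U f"
| "Ck_on (Suc k) f U \<longleftrightarrow> (\<forall>x\<in>U. f differentiable (at x)) \<and>
     (\<forall>v. Ck_on k (\<lambda>x. frechet_derivative f (at x) v) U)"

text \<open>Multi-indices are the functions \<open>\<alpha>\<close> on the standard basis, made unique by requiring
  \<open>\<alpha> b = 0\<close> off the basis.\<close>

definition locally_power_series ::
    "('a::euclidean_space \<Rightarrow> 'b::real_normed_vector) \<Rightarrow> 'a \<Rightarrow> bool" where
  "locally_power_series f x \<longleftrightarrow>
     (\<exists>c. \<exists>\<epsilon>>0. \<forall>y\<in>ball x \<epsilon>.
        ((\<lambda>\<alpha>. (\<Prod>b\<in>Basis. ((y - x) \<bullet> b) ^ \<alpha> b) *\<^sub>R c \<alpha>) has_sum f y)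
          {\<alpha> :: 'a \<Rightarrow> nat. \<forall>b. b \<notin> Basis \<longrightarrow> \<alpha> b = 0})"

text \<open>For \<open>Comega\<close> the $C^\infty$ clause is implied by the other one.\<close>

definition reg_on ::
    "regularity \<Rightarrow> ('a::euclidean_space \<Rightarrow> 'b::real_normed_vector) \<Rightarrow> 'a set \<Rightarrow> bool" where
  "reg_on r f U \<longleftrightarrow> (case r of
       Ck k \<Rightarrow> Ck_on k f U
     | Cinf \<Rightarrow> (\<forall>k. Ck_on k f U)
     | Comega \<Rightarrow> (\<forall>k. Ck_on k f U) \<and> (\<forall>x\<in>U. locally_power_series f x))"

text \<open>Embedded submanifolds of real dimension \<open>d\<close>, by local straightening diffeomorphisms
  \<open>\<phi>\<close> of the ambient space, with inverse \<open>\<psi>\<close>.\<close>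

definition embedded_submanifold :: "regularity \<Rightarrow> nat \<Rightarrow> 'a::euclidean_space set \<Rightarrow> bool" where
  "embedded_submanifold r d M \<longleftrightarrow>
     (\<forall>p\<in>M. \<exists>U U' W \<phi> \<psi>. open U \<and> p \<in> U \<and> open U' \<and> subspace W \<and> dim W = d \<and>
        homeomorphism U U' \<phi> \<psi> \<and> reg_on r \<phi> U \<and> reg_on r \<psi> U' \<and>
        \<phi> ` (U \<inter> M) = U' \<inter> (W :: 'a set))"

definition tangent_space :: "'a::real_normed_vector set \<Rightarrow> 'a \<Rightarrow> 'a set" where
  "tangent_space M p =
     {v. \<exists>\<gamma> :: real \<Rightarrow> 'a. \<gamma> 0 = p \<and> (\<forall>\<^sub>F t in at 0. \<gamma> t \<in> M) \<and>
           (\<gamma> has_vector_derivative v) (at 0)}"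

text \<open>Maps defined on a subset of the ambient space: regular means locally the restriction
  of a regular map on an open set of the ambient space.\<close>

definition reg_on_subset ::
    "regularity \<Rightarrow> ('a::euclidean_space \<Rightarrow> 'b::real_normed_vector) \<Rightarrow> 'a set \<Rightarrow> bool" where
  "reg_on_subset r f V \<longleftrightarrow>
     (\<forall>p\<in>V. \<exists>U g. open U \<and> p \<in> U \<and> reg_on r g U \<and> (\<forall>x\<in>U \<inter> V. g x = f x))"

text \<open>The complexification of a real vector space \<open>E\<close> is \<open>E \<times> E\<close>, where \<open>(u, v)\<close> stands for
  \<open>1 \<otimes> u + \<i> \<otimes> v\<close>. This \<open>\<i>\<close> is to be distinguished from the complex structure of \<open>E\<close>.\<close>

type_synonym 'a complexified = "'a \<times> 'a"

definition cscale :: "complex \<Rightarrow> 'a::real_vector complexified \<Rightarrow> 'a complexified" where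
  "cscale z X = (Re z *\<^sub>R fst X - Im z *\<^sub>R snd X, Re z *\<^sub>R snd X + Im z *\<^sub>R fst X)"

definition cconj :: "'a::real_vector complexified \<Rightarrow> 'a complexified" where
  "cconj X = (fst X, - snd X)"

interpretation cplx: vector_space "cscale :: complex \<Rightarrow> 'a::real_vector complexified \<Rightarrow> 'a complexified"
  by unfold_locales (auto simp: cscale_def algebra_simps)

definition ctangent :: "'a::real_normed_vector set \<Rightarrow> 'a \<Rightarrow> 'a complexified set" where
  "ctangent M p = tangent_space M p \<times> tangent_space M p"

text \<open>The derivative at \<open>p\<close> of a map on \<open>M\<close>, in a tangent direction \<open>v\<close>. The value of
  \<open>D\<close> at vectors tangent to \<open>M\<close> does not depend on the choice of the derivative \<open>D\<close> within \<open>M\<close>.\<close>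

definition tangential_derivative ::
    "'a::real_normed_vector set \<Rightarrow> ('a \<Rightarrow> 'b::real_normed_vector) \<Rightarrow> 'a \<Rightarrow> 'a \<Rightarrow> 'b" where
  "tangential_derivative M f p v =
     (THE w. \<exists>D. (f has_derivative D) (at p within M) \<and> w = D v)"

definition cderivative ::
    "'a::real_normed_vector set \<Rightarrow> ('a \<Rightarrow> 'a complexified) \<Rightarrow> 'a \<Rightarrow> 'a complexified \<Rightarrow> 'a complexified" where
  "cderivative M Y p X =
     tangential_derivative M Y p (fst X) + cscale \<i> (tangential_derivative M Y p (snd X))"

text \<open>Lie bracket of complex vector fields tangent to \<open>M\<close>, in the linear coordinates of the
  ambient space. At points of a relatively open subset of \<open>M\<close> it depends only on
  the values of the fields on that subset.\<close>

definition lie_bracket ::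
    "'a::real_normed_vector set \<Rightarrow> ('a \<Rightarrow> 'a complexified) \<Rightarrow> ('a \<Rightarrow> 'a complexified) \<Rightarrow> 'a \<Rightarrow> 'a complexified" where
  "lie_bracket M X Y p = cderivative M Y p (X p) - cderivative M X p (Y p)"

definition local_section ::
    "regularity \<Rightarrow> ('a::euclidean_space \<Rightarrow> 'a complexified set) \<Rightarrow> 'a set \<Rightarrow> ('a \<Rightarrow> 'a complexified) \<Rightarrow> bool" where
  "local_section r E V X \<longleftrightarrow> reg_on_subset r X V \<and> (\<forall>p\<in>V. X p \<in> E p)"

definition local_frame ::
    "regularity \<Rightarrow> ('a::euclidean_space \<Rightarrow> 'a complexified set) \<Rightarrow> 'a set \<Rightarrow>
      ('a \<Rightarrow> 'a complexified ^ 'n) \<Rightarrow> bool" where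
  "local_frame r E V F \<longleftrightarrow>
     (\<forall>i. local_section r E V (\<lambda>p. F p $ i)) \<and>
     (\<forall>p\<in>V. inj (\<lambda>i. F p $ i) \<and> cplx.independent (range (\<lambda>i. F p $ i)) \<and>
             cplx.span (range (\<lambda>i. F p $ i)) = E p)"

definition J :: "complex ^ 'n \<Rightarrow> complex ^ 'n" where
  "J v = \<i> *s v"

definition CR_generic :: "(complex ^ 'n) set \<Rightarrow> bool" where
  "CR_generic M \<longleftrightarrow>
     (\<forall>p\<in>M. {u + J v | u v. u \<in> tangent_space M p \<and> v \<in> tangent_space M p} = UNIV)"

text \<open>$(1,0)$ vectors: those on which the complex-linear extension of \<open>J\<close> is multiplication
  by \<open>\<i>\<close>.\<close>

definition T10 :: "(complex ^ 'n) set \<Rightarrow> complex ^ 'n \<Rightarrow> (complex ^ 'n) complexified set" where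
  "T10 M p = {X \<in> ctangent M p. (J (fst X), J (snd X)) = cscale \<i> X}"

text \<open>The class \<open>r\<close> is that of \<open>M\<close>; sections of its tangent bundles lose one derivative.\<close>

definition local_generator ::
    "regularity \<Rightarrow> (complex ^ 'n) set \<Rightarrow> (complex ^ 'n) set \<Rightarrow>
      (complex ^ 'n \<Rightarrow> (complex ^ 'n) complexified) \<Rightarrow> bool" where
  "local_generator r M V L \<longleftrightarrow>
     openin (top_of_set M) V \<and> local_section (drop_reg r 1) (T10 M) V L \<and> (\<forall>p\<in>V. L p \<noteq> 0)"

definition class_III1 :: "regularity \<Rightarrow> (complex ^ 4) set \<Rightarrow> bool" where
  "class_III1 r M \<longleftrightarrow>
     (\<forall>V L. local_generator r M V L \<longrightarrow>
        (let L' = (\<lambda>q. cconj (L q)); B = lie_bracket M L L' in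
         \<forall>p\<in>V. cplx.dim {L p, L' p, B p, lie_bracket M L B p, lie_bracket M L' B p} = 5))"

definition field_T ::
    "(complex ^ 'n) set \<Rightarrow> (complex ^ 'n \<Rightarrow> (complex ^ 'n) complexified) \<Rightarrow>
      complex ^ 'n \<Rightarrow> (complex ^ 'n) complexified" where
  "field_T M L p = cscale \<i> (lie_bracket M L (\<lambda>q. cconj (L q)) p)"

definition field_S ::
    "(complex ^ 'n) set \<Rightarrow> (complex ^ 'n \<Rightarrow> (complex ^ 'n) complexified) \<Rightarrow>
      complex ^ 'n \<Rightarrow> (complex ^ 'n) complexified" where
  "field_S M L = lie_bracket M L (field_T M L)"

definition associated_frame ::
    "(complex ^ 'n) set \<Rightarrow> (complex ^ 'n \<Rightarrow> (complex ^ 'n) complexified) \<Rightarrow>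
      complex ^ 'n \<Rightarrow> (complex ^ 'n) complexified ^ 5" where
  "associated_frame M L p =
     vector [L p, cconj (L p), field_T M L p, field_S M L p, cconj (field_S M L p)]"

definition GL :: "(complex ^ 'n ^ 'n) monoid" where
  "GL = \<lparr>carrier = {A. invertible A}, mult = (**), one = mat 1\<rparr>"

text \<open>A matrix of scalars times a column of complexified vectors.\<close>

definition frame_action ::
    "complex ^ 'n ^ 'm \<Rightarrow> 'a::real_vector complexified ^ 'n \<Rightarrow> 'a complexified ^ 'm" where
  "frame_action A F = (\<chi> i. \<Sum>j\<in>UNIV. cscale (A $ i $ j) (F $ j))"

definition associated_frames_reduce_to ::
    "regularity \<Rightarrow> (complex ^ 'n) set \<Rightarrow> (complex ^ 5 ^ 5) set \<Rightarrow> bool" where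
  "associated_frames_reduce_to r M G \<longleftrightarrow>
     subgroup G GL \<and> closedin (top_of_set (carrier GL)) G \<and>
     (\<forall>V L\<^sub>1 L\<^sub>2. local_generator r M V L\<^sub>1 \<and> local_generator r M V L\<^sub>2 \<longrightarrow>
        (\<forall>p\<in>V. \<exists>A\<in>G. associated_frame M L\<^sub>2 p = frame_action A (associated_frame M L\<^sub>1 p)))"

definition G_III1_initial :: "(complex ^ 5 ^ 5) set" where
  "G_III1_initial =
     {vector [vector [a,     0,     0,         0,             0],
              vector [0,     cnj a, 0,         0,             0],
              vector [b,     cnj b, a * cnj a, 0,             0],
              vector [e,     d,     c,         a * a * cnj a, 0],
              vector [cnj d, cnj e, cnj c,     0,             a * cnj a * cnj a]]
      | a b c d e. a \<noteq> 0}"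

end

theory Submission
  imports Defs
begin

text \<open>
  Genericity makes \<open>T10 M p\<close> a complex line, since \<open>T\<^sub>pM \<inter> J T\<^sub>pM\<close> has real dimension \<open>5 + 5 - 8 = 2\<close>.
  So two generators satisfy \<open>L\<^sub>2 = a L\<^sub>1\<close>, where \<open>a\<close> is a Hermitian quotient, hence of class \<open>C\<^sup>2\<close>. With \<open>L'\<close> for
  the conjugate of \<open>L = L\<^sub>1\<close>, the Leibniz rule for brackets gives \<open>T\<^sub>2 = a a' T + b L + b' L'\<close> with
  \<open>b = -\<i> a' L'(a)\<close>, and then \<open>S\<^sub>2 = [a L, T\<^sub>2] = a a a' S + c T + d L' + e L\<close>; here \<open>[L, L'] = -\<i> T\<close> prevents
  any new direction from appearing. The remaining row is the conjugate one, because \<open>T\<close> is real.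

  Brackets of tangent fields are tangent by the symmetry of second derivatives in a straightening chart.
  In the real-analytic case, regularity of the frame needs products and partial derivatives of
  multivariate power series.
\<close>

section \<open>Maps of class $C^k$\<close>

text \<open>The fields live on \<open>M\<close> only, so derivatives are meaningful only in
  directions tangent to \<open>M\<close>. This shapes the calculus: the rules for brackets require
  tangent arguments, and [L, T] is intrinsic only once T is known to be tangent. The bound 3 on the
  smoothness counts derivatives: for \<open>M\<close> of class C^k, L is of class C^(k-1), T of
  class C^(k-2) and S of class C^(k-3), so C^3 leaves a continuous frame. In the change of
  generator, b contains one derivative of a, and [a L, T_2] differentiates b once more; this is why
  a has to be C^2. The coefficients c, d, e are never differentiated and the group imposes no
  relation on them, so they are needed at single points only. The group is not closed among all
  matrices, since a can tend to 0. It is closed in \<open>GL\<close>, because a limit with a = 0 has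
  a vanishing first row.\<close>

lemma Ck_on_cong:
  assumes "open U" "\<And>x. x \<in> U \<Longrightarrow> f x = g x" "Ck_on k f U"
  shows "Ck_on k g U"
  using assms(2,3)
proof (induction k arbitrary: f g)
  case 0
  then show ?case by (simp cong: continuous_on_cong)
next
  case (Suc k)
  have der: "(g has_derivative frechet_derivative f (at x)) (at x)" if "x \<in> U" for x
    using that Suc.prems has_derivative_transform_within_open[of f _ x UNIV U g] \<open>open U\<close>
    by (auto simp: frechet_derivative_works)
  have "Ck_on k (\<lambda>x. frechet_derivative g (at x) v) U" for v
  proof (rule Suc.IH)
    show "Ck_on k (\<lambda>x. frechet_derivative f (at x) v) U" using Suc.prems by simp
    show "\<And>x. x \<in> U \<Longrightarrow> frechet_derivative f (at x) v = frechet_derivative g (at x) v"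
      using frechet_derivative_at[OF der] by simp
  qed
  then show ?case using der by (auto simp: differentiable_def)
qed

lemma Ck_on_subset: "Ck_on k f U \<Longrightarrow> V \<subseteq> U \<Longrightarrow> Ck_on k f V"
  by (induction k arbitrary: f) (auto intro: continuous_on_subset)

lemma Ck_on_frechet_derivative:
  "Ck_on (Suc k) f U \<Longrightarrow> Ck_on k (\<lambda>x. frechet_derivative f (at x) v) U"
  by simp

lemma Ck_on_Suc_has_derivative:
  "Ck_on (Suc k) f U \<Longrightarrow> x \<in> U \<Longrightarrow> (f has_derivative frechet_derivative f (at x)) (at x)"
  by (simp add: frechet_derivative_works)

lemma Ck_on_SucD: "Ck_on (Suc k) f U \<Longrightarrow> Ck_on k f U"
proof (induction k arbitrary: f)
  case 0
  then show ?case
    by (simp add: continuous_at_imp_continuous_on differentiable_imp_continuous_within)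
next
  case (Suc k)
  have "\<forall>x\<in>U. f differentiable at x" using Suc.prems Ck_on.simps(2) by blast
  moreover have "Ck_on k (\<lambda>x. frechet_derivative f (at x) v) U" for v
    by (rule Suc.IH[OF Ck_on_frechet_derivative[OF Suc.prems]])
  ultimately show ?case using Ck_on.simps(2) by blast
qed

lemma Ck_on_le:
  assumes "Ck_on k f U" "j \<le> k"
  shows "Ck_on j f U"
  using assms(2,1) by (induction rule: inc_induct) (blast dest: Ck_on_SucD)+

lemma Ck_on_has_derivative:
  assumes "Ck_on k f U" "k \<ge> 1" "x \<in> U"
  shows "(f has_derivative frechet_derivative f (at x)) (at x)"
  using Ck_on_Suc_has_derivative[of 0] Ck_on_le[OF assms(1,2)] assms(3) by simp

text \<open>Admits any pointwise derivative \<open>f'\<close> in place of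
  \<open>frechet_derivative\<close>, so that each differentiation rule supplies the inductive step
  with its own formula.\<close>

lemma Ck_on_SucI:
  assumes "open U" "\<And>x. x \<in> U \<Longrightarrow> (f has_derivative f' x) (at x)"
    "\<And>v. Ck_on k (\<lambda>x. f' x v) U"
  shows "Ck_on (Suc k) f U"
proof -
  have "Ck_on k (\<lambda>x. frechet_derivative f (at x) v) U" for v
  proof (rule Ck_on_cong[OF assms(1) _ assms(3)])
    show "f' x v = frechet_derivative f (at x) v" if "x \<in> U" for x
      using frechet_derivative_at[OF assms(2)[OF that]] by simp
  qed
  then show ?thesis using assms(2) by (auto simp: differentiable_def)
qed

lemma Ck_on_const: "open U \<Longrightarrow> Ck_on k (\<lambda>x. c) U"
  by (induction k arbitrary: c) simp_all

lemma Ck_on_add: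
  assumes "open U" "Ck_on k f U" "Ck_on k g U"
  shows "Ck_on k (\<lambda>x. f x + g x) U"
  using assms(2,3)
proof (induction k arbitrary: f g)
  case 0
  then show ?case by (simp add: continuous_on_add)
next
  case (Suc k)
  show ?case
    by (rule Ck_on_SucI[OF \<open>open U\<close> has_derivative_add[OF
          Suc.prems[THEN Ck_on_Suc_has_derivative]]
          Suc.IH[OF Suc.prems[THEN Ck_on_frechet_derivative]]])
qed

lemma Ck_on_bounded_linear:
  assumes "open U" "bounded_linear T" "Ck_on k f U"
  shows "Ck_on k (\<lambda>x. T (f x)) U"
  using assms(3)
proof (induction k arbitrary: f)
  case 0
  then show ?case using assms(2) by (simp add: bounded_linear.continuous_on)
next
  case (Suc k)
  show ?case
    by (rule Ck_on_SucI[OF \<open>open U\<close> bounded_linear.has_derivative[OF assms(2)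
          Ck_on_Suc_has_derivative[OF Suc.prems]]
          Suc.IH[OF Ck_on_frechet_derivative[OF Suc.prems]]])
qed

text \<open>The terms B f g' and B f' g also contain the undifferentiated factors, so the induction
  uses \<open>f\<close> and \<open>g\<close> in the lower class as well. Real bilinearity covers
  products, inner products and \<open>cscale\<close> at once.\<close>

lemma Ck_on_bounded_bilinear:
  assumes "open U" "bounded_bilinear B" "Ck_on k f U" "Ck_on k g U"
  shows "Ck_on k (\<lambda>x. B (f x) (g x)) U"
  using assms(3,4)
proof (induction k arbitrary: f g)
  case 0
  then show ?case using assms(2) by (simp add: bounded_bilinear.continuous_on)
next
  case (Suc k)
  note prems' = Suc.prems[THEN Ck_on_SucD] and deriv = Suc.prems[THEN Ck_on_frechet_derivative]
  show ?case
    by (rule Ck_on_SucI[OF \<open>open U\<close> bounded_bilinear.FDERIV[OF assms(2)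
          Suc.prems[THEN Ck_on_Suc_has_derivative]]
          Ck_on_add[OF \<open>open U\<close> Suc.IH[OF prems'(1) deriv(2)] Suc.IH[OF deriv(1) prems'(2)]]])
qed

text \<open>The derivative of 1/f contains 1/f again, but only one class lower, where the induction
  hypothesis supplies it.\<close>

lemma Ck_on_inverse:
  fixes f :: "'a::real_normed_vector \<Rightarrow> real"
  assumes "open U" "\<And>x. x \<in> U \<Longrightarrow> f x \<noteq> 0" "Ck_on k f U"
  shows "Ck_on k (\<lambda>x. inverse (f x)) U"
  using assms(3)
proof (induction k)
  case 0
  then show ?case using assms(2) by (simp add: continuous_on_inverse)
next
  case (Suc k)
  note mult = Ck_on_bounded_bilinear[OF \<open>open U\<close> bounded_bilinear_mult]
    and uminus = Ck_on_bounded_linear[OF \<open>open U\<close> bounded_linear_minus[OF bounded_linear_ident]]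
  have inv: "Ck_on k (\<lambda>x. inverse (f x)) U" by (rule Suc.IH[OF Ck_on_SucD[OF Suc.prems]])
  show ?case
    by (rule Ck_on_SucI[OF \<open>open U\<close> Deriv.has_derivative_inverse[OF assms(2)
          Ck_on_Suc_has_derivative[OF Suc.prems]]
          uminus[OF mult[OF mult[OF inv Ck_on_frechet_derivative[OF Suc.prems]] inv]]])
qed

lemma Ck_on_ident: "open U \<Longrightarrow> Ck_on k (\<lambda>x. x) U"
proof (cases k)
  case (Suc m)
  assume "open U"
  then show ?thesis unfolding Suc
    by (intro Ck_on_SucI[where f' = "\<lambda>x v. v"]) (auto intro: Ck_on_const)
qed simp

section \<open>Multivariate power series\<close>

definition multi_indices :: "('a::euclidean_space \<Rightarrow> nat) set" where
  "multi_indices = {\<alpha>. \<forall>b. b \<notin> Basis \<longrightarrow> \<alpha> b = 0}"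

definition monomial :: "('a::euclidean_space \<Rightarrow> nat) \<Rightarrow> 'a \<Rightarrow> real" where
  "monomial \<alpha> z = (\<Prod>b\<in>Basis. (z \<bullet> b) ^ \<alpha> b)"

lemma locally_power_series_iff:
  "locally_power_series f x \<longleftrightarrow> (\<exists>c. \<exists>\<epsilon>>0. \<forall>y\<in>ball x \<epsilon>.
     ((\<lambda>\<alpha>. monomial \<alpha> (y - x) *\<^sub>R c \<alpha>) has_sum f y) multi_indices)"
  unfolding locally_power_series_def monomial_def multi_indices_def ..

lemma summable_on_sum_finite:
  fixes f :: "'i \<Rightarrow> 'j \<Rightarrow> 'b::topological_comm_monoid_add"
  shows "(\<And>j. j \<in> I \<Longrightarrow> (\<lambda>i. f i j) summable_on A) \<Longrightarrow> (\<lambda>i. \<Sum>j\<in>I. f i j) summable_on A"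
  by (induction I rule: infinite_finite_induct) (auto intro: summable_on_add)

text \<open>In finite dimension unconditional summability is absolute: the two agree for real
  families, and the norm is at most the sum of the absolute values of the coordinates.\<close>

lemma summable_on_norm:
  fixes f :: "'i \<Rightarrow> 'b::euclidean_space"
  assumes "f summable_on A"
  shows "(\<lambda>i. norm (f i)) summable_on A"
proof (rule Infinite_Sum.abs_summable_on_comparison_test')
  have "(\<lambda>i. \<bar>f i \<bullet> b\<bar>) summable_on A" for b
    using summable_on_bounded_linear[OF bounded_linear_inner_left assms, of b]
      summable_on_iff_abs_summable_on_real[of "\<lambda>i. f i \<bullet> b"] by simp
  then show "(\<lambda>i. \<Sum>b\<in>Basis. \<bar>f i \<bullet> b\<bar>) summable_on A"
    by (intro summable_on_sum_finite)
qed (rule norm_le_l1)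

text \<open>Both families converge absolutely, so \<open>K\<close> times the product of the norms
  majorises the double family; its value is then found by summing over \<open>j\<close> and
  afterwards over \<open>i\<close>.\<close>

lemma has_sum_bounded_bilinear:
  fixes f :: "'i \<Rightarrow> 'b::euclidean_space" and g :: "'j \<Rightarrow> 'c::euclidean_space"
    and B :: "'b \<Rightarrow> 'c \<Rightarrow> 'd::banach"
  assumes B: "bounded_bilinear B" and f: "(f has_sum s) A" and g: "(g has_sum t) C"
  shows "((\<lambda>(i, j). B (f i) (g j)) has_sum B s t) (A \<times> C)"
proof (rule has_sum_SigmaI)
  show "((\<lambda>j. case (i, j) of (i, j) \<Rightarrow> B (f i) (g j)) has_sum B (f i) t) C" for i
    using has_sum_bounded_linear[OF bounded_bilinear.bounded_linear_right[OF B] g] by simp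
  show "((\<lambda>i. B (f i) t) has_sum B s t) A"
    using has_sum_bounded_linear[OF bounded_bilinear.bounded_linear_left[OF B] f] by simp
  obtain K where K: "\<And>a b. norm (B a b) \<le> norm a * norm b * K"
    using bounded_bilinear.bounded[OF B] by blast
  have nf: "(\<lambda>i. norm (f i)) summable_on A" and ng: "(\<lambda>j. norm (g j)) summable_on C"
    using summable_on_norm f g has_sum_imp_summable by blast+
  have "(\<lambda>(i, j). norm (f i) * norm (g j)) summable_on A \<times> C"
  proof (rule summable_on_SigmaI)
    show "((\<lambda>j. case (i, j) of (i, j) \<Rightarrow> norm (f i) * norm (g j)) has_sum
        norm (f i) * infsum (\<lambda>j. norm (g j)) C) C" for i
      using has_sum_cmult_right[OF has_sum_infsum[OF ng]] by simp
    show "(\<lambda>i. norm (f i) * infsum (\<lambda>j. norm (g j)) C) summable_on A"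
      using summable_on_cmult_left nf by blast
  qed simp
  then have "(\<lambda>p. (case p of (i, j) \<Rightarrow> norm (f i) * norm (g j)) * K) summable_on A \<times> C"
    by (rule summable_on_cmult_left)
  then have "(\<lambda>p. norm (case p of (i, j) \<Rightarrow> B (f i) (g j))) summable_on A \<times> C"
    by (rule Infinite_Sum.abs_summable_on_comparison_test') (use K in auto)
  then show "(\<lambda>(i, j). B (f i) (g j)) summable_on A \<times> C"
    by (rule abs_summable_summable)
qed

text \<open>Both exponents are bounded by \<gamma>, so only finitely many terms enter one
  coefficient of a Cauchy product.\<close>

lemma finite_multi_index_splittings:
  "finite {(\<alpha>, \<beta>). \<alpha> \<in> multi_indices \<and> \<beta> \<in> multi_indices \<and> (\<lambda>b. \<alpha> b + \<beta> b) = \<gamma>}" (is "finite ?S")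
proof -
  let ?T = "{\<alpha> :: 'a \<Rightarrow> nat. \<forall>b. (b \<in> Basis \<longrightarrow> \<alpha> b \<in> {..Max (\<gamma> ` Basis)}) \<and> (b \<notin> Basis \<longrightarrow> \<alpha> b = (0::nat))}"
  have "?S \<subseteq> ?T \<times> ?T"
  proof
    fix p assume "p \<in> ?S"
    then obtain \<alpha> \<beta> where p: "p = (\<alpha>, \<beta>)"
      and *: "\<alpha> \<in> multi_indices" "\<beta> \<in> multi_indices" "\<gamma> = (\<lambda>b. \<alpha> b + \<beta> b)" by auto
    have "\<gamma> b \<le> Max (\<gamma> ` Basis)" if "b \<in> Basis" for b using that by simp
    then have "\<alpha> b \<le> Max (\<gamma> ` Basis)" "\<beta> b \<le> Max (\<gamma> ` Basis)" if "b \<in> Basis" for b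
      using that *(3) by (meson add_leE)+
    then show "p \<in> ?T \<times> ?T" using *(1,2) by (auto simp: p multi_indices_def)
  qed
  moreover have "finite ?T" by (rule finite_set_of_finite_funs) auto
  ultimately show ?thesis by (meson finite_SigmaI finite_subset)
qed

lemma monomial_add: "monomial (\<lambda>b. \<alpha> b + \<beta> b) z = monomial \<alpha> z * monomial \<beta> z"
  by (simp add: monomial_def power_add prod.distrib)

text \<open>The Cauchy product: the double series is regrouped according to the sum of the two
  exponents.\<close>

lemma locally_power_series_bounded_bilinear:
  fixes f :: "'a::euclidean_space \<Rightarrow> 'b::euclidean_space" and g :: "'a \<Rightarrow> 'c::euclidean_space"
    and B :: "'b \<Rightarrow> 'c \<Rightarrow> 'd::banach"
  assumes B: "bounded_bilinear B" and f: "locally_power_series f x" and g: "locally_power_series g x"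
  shows "locally_power_series (\<lambda>y. B (f y) (g y)) x"
proof -
  obtain c \<epsilon> where c: "\<epsilon> > 0"
    "\<And>y. y \<in> ball x \<epsilon> \<Longrightarrow> ((\<lambda>\<alpha>. monomial \<alpha> (y - x) *\<^sub>R c \<alpha>) has_sum f y) multi_indices"
    using f unfolding locally_power_series_iff by blast
  obtain d \<delta> where d: "\<delta> > 0"
    "\<And>y. y \<in> ball x \<delta> \<Longrightarrow> ((\<lambda>\<alpha>. monomial \<alpha> (y - x) *\<^sub>R d \<alpha>) has_sum g y) multi_indices"
    using g unfolding locally_power_series_iff by blast
  define S where "S \<gamma> = {(\<alpha>, \<beta>). \<alpha> \<in> multi_indices \<and> \<beta> \<in> multi_indices \<and> (\<lambda>b. \<alpha> b + \<beta> b) = \<gamma>}"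
    for \<gamma> :: "'a \<Rightarrow> nat"
  define e where "e \<gamma> = (\<Sum>(\<alpha>, \<beta>)\<in>S \<gamma>. B (c \<alpha>) (d \<beta>))" for \<gamma>
  have "((\<lambda>\<gamma>. monomial \<gamma> (y - x) *\<^sub>R e \<gamma>) has_sum B (f y) (g y)) multi_indices"
    if y: "y \<in> ball x (min \<epsilon> \<delta>)" for y
  proof -
    let ?h = "\<lambda>(\<alpha>, \<beta>). B (monomial \<alpha> (y - x) *\<^sub>R c \<alpha>) (monomial \<beta> (y - x) *\<^sub>R d \<beta>)"
    have "(?h has_sum B (f y) (g y)) (multi_indices \<times> multi_indices)"
      using y by (intro has_sum_bounded_bilinear B c(2) d(2)) auto
    also have "(?h has_sum B (f y) (g y)) (multi_indices \<times> multi_indices) \<longleftrightarrow>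
      ((\<lambda>p. ?h (snd p)) has_sum B (f y) (g y)) (Sigma multi_indices S)"
      \<comment> \<open>Each pair lies in exactly one fibre \<open>S \<gamma>\<close>, the one
        belonging to its sum.\<close>
      by (rule has_sum_reindex_bij_witness[where i = snd and j = "\<lambda>p. (\<lambda>b. fst p b + snd p b, p)"])
        (auto simp: S_def multi_indices_def)
    finally have *: "((\<lambda>p. ?h (snd p)) has_sum B (f y) (g y)) (Sigma multi_indices S)" .
    show ?thesis
    proof (rule has_sum_SigmaD[OF *])
      fix \<gamma> :: "'a \<Rightarrow> nat"
      have "(\<Sum>p\<in>S \<gamma>. ?h p) = monomial \<gamma> (y - x) *\<^sub>R e \<gamma>"
        unfolding e_def scaleR_sum_right
        by (rule sum.cong)
          (auto simp: S_def monomial_add bounded_bilinear.scaleR_left[OF B]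
            bounded_bilinear.scaleR_right[OF B] simp flip: fun_eq_iff)
      moreover have "finite (S \<gamma>)" unfolding S_def by (rule finite_multi_index_splittings)
      ultimately show "((\<lambda>p. ?h (snd (\<gamma>, p))) has_sum monomial \<gamma> (y - x) *\<^sub>R e \<gamma>) (S \<gamma>)"
        by (simp add: has_sum_finiteI)
    qed
  qed
  then show ?thesis unfolding locally_power_series_iff
    using c(1) d(1) by (intro exI[of _ e] exI[of _ "min \<epsilon> \<delta>"]) auto
qed

lemma locally_power_series_add:
  assumes f: "locally_power_series f x" and g: "locally_power_series g x"
  shows "locally_power_series (\<lambda>y. f y + g y) x"
proof -
  obtain c \<epsilon> where c: "\<epsilon> > 0"
    "\<And>y. y \<in> ball x \<epsilon> \<Longrightarrow> ((\<lambda>\<alpha>. monomial \<alpha> (y - x) *\<^sub>R c \<alpha>) has_sum f y) multi_indices"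
    using f unfolding locally_power_series_iff by blast
  obtain d \<delta> where d: "\<delta> > 0"
    "\<And>y. y \<in> ball x \<delta> \<Longrightarrow> ((\<lambda>\<alpha>. monomial \<alpha> (y - x) *\<^sub>R d \<alpha>) has_sum g y) multi_indices"
    using g unfolding locally_power_series_iff by blast
  have "((\<lambda>\<alpha>. monomial \<alpha> (y - x) *\<^sub>R (c \<alpha> + d \<alpha>)) has_sum (f y + g y)) multi_indices"
    if "y \<in> ball x (min \<epsilon> \<delta>)" for y
    unfolding scaleR_add_right using that by (intro has_sum_add c(2) d(2)) auto
  then show ?thesis unfolding locally_power_series_iff
    using c(1) d(1) by (intro exI[of _ "\<lambda>\<alpha>. c \<alpha> + d \<alpha>"] exI[of _ "min \<epsilon> \<delta>"]) auto
qed

lemma locally_power_series_bounded_linear: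
  assumes T: "bounded_linear T" and f: "locally_power_series f x"
  shows "locally_power_series (\<lambda>y. T (f y)) x"
proof -
  obtain c \<epsilon> where c: "\<epsilon> > 0"
    "\<And>y. y \<in> ball x \<epsilon> \<Longrightarrow> ((\<lambda>\<alpha>. monomial \<alpha> (y - x) *\<^sub>R c \<alpha>) has_sum f y) multi_indices"
    using f unfolding locally_power_series_iff by blast
  have "((\<lambda>\<alpha>. monomial \<alpha> (y - x) *\<^sub>R T (c \<alpha>)) has_sum T (f y)) multi_indices"
    if "y \<in> ball x \<epsilon>" for y
    using has_sum_bounded_linear[OF T c(2)[OF that]]
    by (simp add: linear_simps(5)[OF T])
  then show ?thesis unfolding locally_power_series_iff
    using c(1) by (intro exI[of _ "\<lambda>\<alpha>. T (c \<alpha>)"] exI[of _ \<epsilon>]) auto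
qed

lemma locally_power_series_cong:
  assumes "open U" "x \<in> U" "\<And>y. y \<in> U \<Longrightarrow> f y = g y" and f: "locally_power_series f x"
  shows "locally_power_series g x"
proof -
  obtain c \<epsilon> where c: "\<epsilon> > 0"
    "\<And>y. y \<in> ball x \<epsilon> \<Longrightarrow> ((\<lambda>\<alpha>. monomial \<alpha> (y - x) *\<^sub>R c \<alpha>) has_sum f y) multi_indices"
    using f unfolding locally_power_series_iff by blast
  obtain \<delta> where d: "\<delta> > 0" "ball x \<delta> \<subseteq> U" using assms(1,2) openE by blast
  have "((\<lambda>\<alpha>. monomial \<alpha> (y - x) *\<^sub>R c \<alpha>) has_sum g y) multi_indices"
    if "y \<in> ball x (min \<epsilon> \<delta>)" for y
    using c(2)[of y] assms(3)[of y] d(2) that by auto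
  then show ?thesis unfolding locally_power_series_iff
    using c(1) d(1) by (intro exI[of _ c] exI[of _ "min \<epsilon> \<delta>"]) auto
qed

section \<open>Termwise differentiation of power series\<close>

lemma real_mult_le_power2: "real n * real (n - 1) \<le> 2 * 2 ^ n"
proof (cases n)
  case (Suc m)
  have "m * Suc m \<le> 4 * 2 ^ m" for m :: nat
  proof (induction m)
    case (Suc m)
    have "Suc m \<le> 2 ^ m" using less_exp[of m] by (rule Suc_leI)
    then show ?case using Suc by simp
  qed simp
  from of_nat_mono[OF this[of m], where 'a = real] show ?thesis
    by (simp add: Suc algebra_simps)
qed simp

lemma has_sum_diff:
  fixes f g :: "'i \<Rightarrow> 'b::real_normed_vector"
  assumes "(f has_sum s) A" "(g has_sum t) A"
  shows "((\<lambda>i. f i - g i) has_sum s - t) A"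
  using has_sum_add[OF assms(1) has_sum_bounded_linear[OF
      bounded_linear_minus[OF bounded_linear_ident] assms(2)]] by simp

text \<open>Differentiation brings in the factors n and n(n - 1). They are O(2^n), hence absorbed by
  halving the radius. The constants do not depend on \<open>n\<close>, so both bounds can be summed
  against the coefficients of a series. The second one is the quadratic Taylor remainder.\<close>

lemma power_diff_bounds:
  fixes a h \<rho> :: real
  assumes "\<rho> > 0" "\<bar>a\<bar> \<le> \<rho> / 2" "\<bar>a + h\<bar> \<le> \<rho> / 2"
  shows "\<bar>real n * a ^ (n - 1)\<bar> \<le> 2 / \<rho> * \<rho> ^ n"
    and "\<bar>(a + h) ^ n - a ^ n - h * (real n * a ^ (n - 1))\<bar> \<le> 8 / \<rho>\<^sup>2 * \<rho> ^ n * h\<^sup>2"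
proof -
  show "\<bar>real n * a ^ (n - 1)\<bar> \<le> 2 / \<rho> * \<rho> ^ n"
  proof (cases n)
    case (Suc m)
    have "\<bar>real n * a ^ (n - 1)\<bar> \<le> 2 ^ n * (\<rho> / 2) ^ (n - 1)"
      unfolding abs_mult power_abs using assms(2) of_nat_less_two_power[of n]
      by (intro mult_mono power_mono) (auto simp: less_imp_le)
    also have "\<dots> = 2 / \<rho> * \<rho> ^ n"
      using \<open>\<rho> > 0\<close> Suc by (simp add: power_divide)
    finally show ?thesis .
  qed (use \<open>\<rho> > 0\<close> in simp)
  show "\<bar>(a + h) ^ n - a ^ n - h * (real n * a ^ (n - 1))\<bar> \<le> 8 / \<rho>\<^sup>2 * \<rho> ^ n * h\<^sup>2"
  proof (cases "h = 0")
    case False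
    have "\<bar>((a + h) ^ n - a ^ n) / h - real n * a ^ (n - 1)\<bar> \<le>
        real n * real (n - 1) * (\<rho> / 2) ^ (n - 2) * \<bar>h\<bar>"
      using lemma_termdiff3[OF False, of a "\<rho> / 2" n] assms(2,3) by simp
    also have "\<dots> \<le> 8 / \<rho>\<^sup>2 * \<rho> ^ n * \<bar>h\<bar>"
    proof (rule mult_right_mono, cases "n \<ge> 2")
      case True
      then obtain m where n: "n = m + 2" by (metis add.commute le_Suc_ex)
      have "real n * real (n - 1) * (\<rho> / 2) ^ (n - 2) \<le> 2 * 2 ^ n * (\<rho> / 2) ^ (n - 2)"
        using \<open>\<rho> > 0\<close> by (intro mult_right_mono real_mult_le_power2) auto
      also have "\<dots> = 8 / \<rho>\<^sup>2 * \<rho> ^ n"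
        using \<open>\<rho> > 0\<close> by (simp add: n power_divide power_add power2_eq_square)
      finally show "real n * real (n - 1) * (\<rho> / 2) ^ (n - 2) \<le> 8 / \<rho>\<^sup>2 * \<rho> ^ n" .
    next
      case False
      then have "n = 0 \<or> n = 1" by auto
      then show "real n * real (n - 1) * (\<rho> / 2) ^ (n - 2) \<le> 8 / \<rho>\<^sup>2 * \<rho> ^ n"
        using \<open>\<rho> > 0\<close> by auto
    qed simp
    finally have "\<bar>((a + h) ^ n - a ^ n) / h - real n * a ^ (n - 1)\<bar> * \<bar>h\<bar> \<le>
        8 / \<rho>\<^sup>2 * \<rho> ^ n * \<bar>h\<bar> * \<bar>h\<bar>"
      by (intro mult_right_mono) auto
    moreover have "\<bar>((a + h) ^ n - a ^ n) / h - real n * a ^ (n - 1)\<bar> * \<bar>h\<bar> =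
      \<bar>(a + h) ^ n - a ^ n - h * (real n * a ^ (n - 1))\<bar>"
      using False by (simp add: field_simps flip: abs_mult)
    ultimately show ?thesis by (simp add: power2_eq_square mult.assoc)
  qed simp
qed

lemma monomial_split:
  assumes "e \<in> Basis"
  shows "monomial \<alpha> z = (z \<bullet> e) ^ \<alpha> e * (\<Prod>b\<in>Basis - {e}. (z \<bullet> b) ^ \<alpha> b)"
  using assms by (simp add: monomial_def prod.remove)

text \<open>In a differentiated series the terms free of the variable along \<open>e\<close> vanish;
  the remaining ones are indexed by all multi-indices again once that exponent is lowered.\<close>

lemma multi_indices_shift:
  assumes "e \<in> Basis"
  shows "((\<lambda>\<alpha>. g (\<alpha>(e := Suc (\<alpha> e)))) has_sum s) multi_indices \<longleftrightarrow>
    (g has_sum s) {\<alpha> \<in> multi_indices. \<alpha> e \<noteq> 0}"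
  by (rule has_sum_reindex_bij_witness[where i = "\<lambda>\<alpha>. \<alpha>(e := \<alpha> e - 1)" and j = "\<lambda>\<alpha>. \<alpha>(e := Suc (\<alpha> e))"])
    (use assms in \<open>auto simp: multi_indices_def\<close>)

text \<open>The series is differentiated in the single variable along \<open>e\<close>, with the
  other coordinates frozen. The remainder is at most C h^2, so the sum \<open>D\<close> of the
  differentiated series is the derivative of \<open>f\<close> along the line. Differentiability of
  \<open>f\<close> identifies \<open>D\<close> with the value of
  \<open>frechet_derivative\<close>.\<close>

lemma locally_power_series_frechet_derivative:
  fixes f :: "'a::euclidean_space \<Rightarrow> 'b::euclidean_space"
  assumes U: "open U" "x \<in> U" and diff: "\<And>y. y \<in> U \<Longrightarrow> f differentiable (at y)"
    and e: "e \<in> Basis" and f: "locally_power_series f x"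
  shows "locally_power_series (\<lambda>y. frechet_derivative f (at y) e) x"
proof -
  obtain c \<epsilon>\<^sub>1 where c1: "\<epsilon>\<^sub>1 > 0"
    "\<And>y. y \<in> ball x \<epsilon>\<^sub>1 \<Longrightarrow> ((\<lambda>\<alpha>. monomial \<alpha> (y - x) *\<^sub>R c \<alpha>) has_sum f y) multi_indices"
    using f unfolding locally_power_series_iff by blast
  obtain \<epsilon>\<^sub>2 where "\<epsilon>\<^sub>2 > 0" "ball x \<epsilon>\<^sub>2 \<subseteq> U" using U openE by blast
  define \<epsilon> where "\<epsilon> = min \<epsilon>\<^sub>1 \<epsilon>\<^sub>2"
  have \<epsilon>: "\<epsilon> > 0" "ball x \<epsilon> \<subseteq> U" and c:
    "\<And>y. y \<in> ball x \<epsilon> \<Longrightarrow> ((\<lambda>\<alpha>. monomial \<alpha> (y - x) *\<^sub>R c \<alpha>) has_sum f y) multi_indices"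
    using c1 \<open>\<epsilon>\<^sub>2 > 0\<close> \<open>ball x \<epsilon>\<^sub>2 \<subseteq> U\<close> by (auto simp: \<epsilon>_def)
  \<comment> \<open>The corner \<open>\<rho> *\<^sub>R \<Sum>Basis\<close>, all of whose coordinates
    are \<rho>, must lie in the ball; its norm is at most \<epsilon> / 2. The summand 1 makes the
    denominator visibly positive and yields \<rho> \<le> \<epsilon> / 2.\<close>
  define \<rho> where "\<rho> = \<epsilon> / (2 * (1 + norm (\<Sum>Basis :: 'a)))"
  have "\<rho> > 0" using \<epsilon>(1) by (simp add: \<rho>_def add_pos_nonneg)
  have "norm (\<rho> *\<^sub>R \<Sum>Basis :: 'a) = \<epsilon> / 2 * (norm (\<Sum>Basis :: 'a) / (1 + norm (\<Sum>Basis :: 'a)))"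
    using \<epsilon>(1) by (simp add: \<rho>_def abs_mult)
  also have "\<dots> \<le> \<epsilon> / 2 * 1"
    using \<epsilon>(1) by (intro mult_left_mono) (auto simp: add_pos_nonneg divide_simps)
  finally have \<rho>1: "norm (\<rho> *\<^sub>R \<Sum>Basis :: 'a) < \<epsilon>" using \<epsilon>(1) by simp
  have "\<rho> \<le> \<epsilon> / 2"
    unfolding \<rho>_def using \<epsilon>(1) by (intro divide_left_mono) (auto intro!: mult_pos_pos add_pos_nonneg)
  then have "\<rho> < \<epsilon>" using \<epsilon>(1) by simp
  have mon\<rho>: "monomial \<alpha> (\<rho> *\<^sub>R \<Sum>Basis) = (\<Prod>b\<in>Basis. \<rho> ^ \<alpha> b)" for \<alpha> :: "'a \<Rightarrow> nat"
    by (simp add: monomial_def inner_sum_left_Basis)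
  \<comment> \<open>Among points with coordinates bounded by \<rho>, every monomial is largest at
    the corner. Absolute convergence there gives one majorant for the whole cube.\<close>
  define m where "m \<alpha> = norm (monomial \<alpha> (\<rho> *\<^sub>R \<Sum>Basis) *\<^sub>R c \<alpha>)" for \<alpha>
  have m_sum: "m summable_on multi_indices"
    unfolding m_def using c[of "x + \<rho> *\<^sub>R \<Sum>Basis"] \<rho>1
    by (intro summable_on_norm) (auto simp: dist_norm intro: has_sum_imp_summable)
  define P where "P \<alpha> z = (\<Prod>b\<in>Basis - {e}. (z \<bullet> b) ^ \<alpha> b)" for \<alpha> and z :: 'a
  have m_eq: "m \<alpha> = \<rho> ^ \<alpha> e * (\<Prod>b\<in>Basis - {e}. \<rho> ^ \<alpha> b) * norm (c \<alpha>)" for \<alpha>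
    using \<open>\<rho> > 0\<close> e by (simp add: m_def mon\<rho> prod.remove[of Basis e] abs_mult prod_nonneg)
  have P_le: "\<bar>P \<alpha> z\<bar> \<le> (\<Prod>b\<in>Basis - {e}. \<rho> ^ \<alpha> b)" if "norm z \<le> \<rho> / 2" for \<alpha> z
    unfolding P_def abs_prod power_abs
  proof (intro prod_mono conjI power_mono)
    fix b :: 'a assume "b \<in> Basis - {e}"
    then show "\<bar>z \<bullet> b\<bar> \<le> \<rho>" using Basis_le_norm[of b z] that \<open>\<rho> > 0\<close> by simp
  qed auto
  have P_shift: "P \<alpha> (z + h *\<^sub>R e) = P \<alpha> z" for \<alpha> z h
    unfolding P_def by (rule prod.cong) (use e in \<open>auto simp: inner_add_left inner_not_same_Basis\<close>)
  have mono_e: "monomial \<alpha> (z + h *\<^sub>R e) = (z \<bullet> e + h) ^ \<alpha> e * P \<alpha> z" for \<alpha> z h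
    using e P_shift unfolding monomial_split[OF e] P_def by (simp add: inner_add_left)
  define d where "d \<alpha> = real (Suc (\<alpha> e)) *\<^sub>R c (\<alpha>(e := Suc (\<alpha> e)))" for \<alpha>
  \<comment> \<open>A quarter of \<rho> for the base point and a quarter for the increment keep the
    coordinate along \<open>e\<close> within \<rho> / 2, as \<open>power_diff_bounds\<close>
    requires.\<close>
  have "((\<lambda>\<alpha>. monomial \<alpha> (y - x) *\<^sub>R d \<alpha>) has_sum frechet_derivative f (at y) e) multi_indices"
    if y: "y \<in> ball x (\<rho> / 4)" for y
  proof -
    define z where "z = y - x"
    have z: "norm z < \<rho> / 4" using y by (simp add: z_def dist_norm norm_minus_commute)
    then have zP: "norm z \<le> \<rho> / 2" using \<open>\<rho> > 0\<close> by simp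
    have ze: "\<bar>z \<bullet> e\<bar> < \<rho> / 4" using Basis_le_norm[OF e, of z] z by simp
    define g where "g \<alpha> = (real (\<alpha> e) * (z \<bullet> e) ^ (\<alpha> e - 1) * P \<alpha> z) *\<^sub>R c \<alpha>" for \<alpha>
    have "norm (g \<alpha>) \<le> 2 / \<rho> * m \<alpha>" for \<alpha>
    proof -
      have "\<bar>real (\<alpha> e) * (z \<bullet> e) ^ (\<alpha> e - 1)\<bar> * \<bar>P \<alpha> z\<bar> * norm (c \<alpha>) \<le>
          (2 / \<rho> * \<rho> ^ \<alpha> e) * (\<Prod>b\<in>Basis - {e}. \<rho> ^ \<alpha> b) * norm (c \<alpha>)"
        using power_diff_bounds(1)[of \<rho> "z \<bullet> e" 0] ze \<open>\<rho> > 0\<close>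
        by (intro mult_right_mono mult_mono P_le zP) auto
      then show ?thesis by (simp add: g_def m_eq abs_mult mult_ac)
    qed
    then have "(\<lambda>\<alpha>. norm (g \<alpha>)) summable_on multi_indices"
      by (rule Infinite_Sum.abs_summable_on_comparison_test'[OF summable_on_cmult_right[OF m_sum]])
    define D where "D = infsum g multi_indices"
    have D: "(g has_sum D) multi_indices"
      unfolding D_def by (rule has_sum_infsum[OF abs_summable_summable]) fact
    define C where "C = 8 / \<rho>\<^sup>2 * infsum m multi_indices"
    have bound: "norm (f (y + h *\<^sub>R e) - f y - h *\<^sub>R D) \<le> C * h\<^sup>2" if h: "\<bar>h\<bar> < \<rho> / 4" for h
    proof (rule norm_infsum_le)
      have "norm (y + h *\<^sub>R e - x) \<le> norm z + norm (h *\<^sub>R e)"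
        unfolding z_def by (metis add_diff_eq add.commute diff_add_eq norm_triangle_ineq)
      also have "\<dots> < \<epsilon>" using h e z \<open>\<rho> < \<epsilon>\<close> \<open>\<rho> > 0\<close> by (simp add: norm_Basis)
      finally have yh: "y + h *\<^sub>R e \<in> ball x \<epsilon>"
        by (simp add: dist_norm norm_minus_commute)
      have y': "y \<in> ball x \<epsilon>" using y \<open>\<rho> < \<epsilon>\<close> \<open>\<rho> > 0\<close> by auto
      have "((\<lambda>\<alpha>. monomial \<alpha> (z + h *\<^sub>R e) *\<^sub>R c \<alpha> - monomial \<alpha> z *\<^sub>R c \<alpha> - h *\<^sub>R g \<alpha>)
          has_sum (f (y + h *\<^sub>R e) - f y - h *\<^sub>R D)) multi_indices"
        unfolding z_def using c[OF yh] c[OF y']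
        by (intro has_sum_diff has_sum_scaleR D) (auto simp: add_diff_eq diff_add_eq)
      moreover have "monomial \<alpha> (z + h *\<^sub>R e) *\<^sub>R c \<alpha> - monomial \<alpha> z *\<^sub>R c \<alpha> - h *\<^sub>R g \<alpha> =
          (((z \<bullet> e + h) ^ \<alpha> e - (z \<bullet> e) ^ \<alpha> e -
            h * (real (\<alpha> e) * (z \<bullet> e) ^ (\<alpha> e - 1))) * P \<alpha> z) *\<^sub>R c \<alpha>" for \<alpha>
        unfolding mono_e mono_e[of \<alpha> z 0, simplified] g_def
        by (simp add: left_diff_distrib scaleR_left_diff_distrib mult.assoc)
      ultimately show "((\<lambda>\<alpha>. (((z \<bullet> e + h) ^ \<alpha> e - (z \<bullet> e) ^ \<alpha> e -
            h * (real (\<alpha> e) * (z \<bullet> e) ^ (\<alpha> e - 1))) * P \<alpha> z) *\<^sub>R c \<alpha>)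
          has_sum (f (y + h *\<^sub>R e) - f y - h *\<^sub>R D)) multi_indices"
        by simp
      show "((\<lambda>\<alpha>. 8 / \<rho>\<^sup>2 * m \<alpha> * h\<^sup>2) has_sum C * h\<^sup>2) multi_indices"
        unfolding C_def by (intro has_sum_cmult_left has_sum_cmult_right has_sum_infsum m_sum)
      fix \<alpha> :: "'a \<Rightarrow> nat"
      have "\<bar>z \<bullet> e + h\<bar> \<le> \<rho> / 2" "\<bar>z \<bullet> e\<bar> \<le> \<rho> / 2"
        using ze h abs_triangle_ineq[of "z \<bullet> e" h] by linarith+
      note power_le = power_diff_bounds(2)[OF \<open>\<rho> > 0\<close> this(2,1), of "\<alpha> e"]
      have "\<bar>(z \<bullet> e + h) ^ \<alpha> e - (z \<bullet> e) ^ \<alpha> e - h * (real (\<alpha> e) * (z \<bullet> e) ^ (\<alpha> e - 1))\<bar> *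
          \<bar>P \<alpha> z\<bar> * norm (c \<alpha>)
        \<le> (8 / \<rho>\<^sup>2 * \<rho> ^ \<alpha> e * h\<^sup>2) * (\<Prod>b\<in>Basis - {e}. \<rho> ^ \<alpha> b) * norm (c \<alpha>)"
        by (intro mult_right_mono mult_mono P_le zP power_le) (use \<open>\<rho> > 0\<close> in auto)
      then show "norm ((((z \<bullet> e + h) ^ \<alpha> e - (z \<bullet> e) ^ \<alpha> e -
            h * (real (\<alpha> e) * (z \<bullet> e) ^ (\<alpha> e - 1))) * P \<alpha> z) *\<^sub>R c \<alpha>) \<le> 8 / \<rho>\<^sup>2 * m \<alpha> * h\<^sup>2"
        by (simp add: m_eq abs_mult mult_ac)
    qed
    have "((\<lambda>h. f (y + h *\<^sub>R e)) has_vector_derivative D) (at 0)"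
      unfolding has_vector_derivative_def has_derivative_at
    proof (intro conjI bounded_linear_scaleR_left)
      have "((\<lambda>h. C * \<bar>h\<bar>) \<longlongrightarrow> C * \<bar>0\<bar>) (at (0::real))" by (intro tendsto_intros)
      moreover have "\<forall>\<^sub>F h in at 0. norm (norm (f (y + (0 + h) *\<^sub>R e) - f (y + 0 *\<^sub>R e) - h *\<^sub>R D) / norm h)
          \<le> C * \<bar>h\<bar>"
      proof (rule eventually_mono[OF eventually_at_ball[of "\<rho> / 4"]])
        show "0 < \<rho> / 4" using \<open>\<rho> > 0\<close> by simp
        fix h :: real assume "h \<in> ball 0 (\<rho> / 4) \<and> h \<in> UNIV"
        then have "norm (f (y + h *\<^sub>R e) - f y - h *\<^sub>R D) \<le> C * h\<^sup>2" using bound by simp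
        also have "C * h\<^sup>2 = C * \<bar>h\<bar> * \<bar>h\<bar>" by (simp add: power2_eq_square)
        finally have "norm (f (y + h *\<^sub>R e) - f y - h *\<^sub>R D) / \<bar>h\<bar> \<le> C * \<bar>h\<bar> * \<bar>h\<bar> / \<bar>h\<bar>"
          by (rule divide_right_mono) simp
        moreover have "C \<ge> 0" unfolding C_def
          by (intro mult_nonneg_nonneg infsum_nonneg) (auto simp: m_def)
        ultimately show "norm (norm (f (y + (0 + h) *\<^sub>R e) - f (y + 0 *\<^sub>R e) - h *\<^sub>R D) / norm h) \<le> C * \<bar>h\<bar>"
          by (cases "h = 0") auto
      qed
      ultimately show "(\<lambda>h. norm (f (y + (0 + h) *\<^sub>R e) - f (y + 0 *\<^sub>R e) - h *\<^sub>R D) / norm h) \<midarrow>0\<rightarrow> 0"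
        using tendsto_0_le[of "\<lambda>h. C * \<bar>h\<bar>" "at 0" _ 1] by (simp add: Lim_null_comparison)
    qed
    moreover have "((\<lambda>h. f (y + h *\<^sub>R e)) has_vector_derivative frechet_derivative f (at y) e) (at 0)"
    proof -
      have "y \<in> U" using y \<epsilon>(2) \<open>\<rho> < \<epsilon>\<close> \<open>\<rho> > 0\<close> by auto
      then have F: "(f has_derivative frechet_derivative f (at y)) (at (y + 0 *\<^sub>R e))"
        using diff by (simp add: frechet_derivative_works)
      have "((\<lambda>h. y + h *\<^sub>R e) has_derivative (\<lambda>h. h *\<^sub>R e)) (at 0)"
        by (auto intro!: derivative_eq_intros)
      from has_derivative_compose[OF this F]
      show ?thesis unfolding has_vector_derivative_def
        by (simp add: linear_simps(5)[OF has_derivative_bounded_linear[OF F]])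
    qed
    ultimately have D_eq: "D = frechet_derivative f (at y) e" by (rule vector_derivative_unique_at)
    \<comment> \<open>Terms with exponent 0 along \<open>e\<close> carry the factor 0 in
      \<open>g\<close> and can be discarded.\<close>
    have "(g has_sum D) {\<alpha> \<in> multi_indices. \<alpha> e \<noteq> 0}"
      using D has_sum_cong_neutral[of multi_indices "{\<alpha> \<in> multi_indices. \<alpha> e \<noteq> 0}" g g D]
      by (auto simp: g_def)
    then have "((\<lambda>\<alpha>. g (\<alpha>(e := Suc (\<alpha> e)))) has_sum D) multi_indices"
      using multi_indices_shift[OF e] by blast
    moreover have "g (\<alpha>(e := Suc (\<alpha> e))) = monomial \<alpha> z *\<^sub>R d \<alpha>" for \<alpha>
    proof -
      have "P (\<alpha>(e := Suc (\<alpha> e))) z = P \<alpha> z" unfolding P_def by (rule prod.cong) auto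
      then show ?thesis
        using mono_e[of \<alpha> z 0] by (simp add: g_def d_def mult_ac)
    qed
    ultimately show ?thesis by (simp add: D_eq z_def)
  qed
  then show ?thesis unfolding locally_power_series_iff
    using \<open>\<rho> > 0\<close> by (intro exI[of _ d] exI[of _ "\<rho> / 4"]) auto
qed

section \<open>Regularity classes on subsets\<close>

text \<open>At least \<open>k\<close> derivatives are available. \<open>Cinf\<close> and
  \<open>Comega\<close> satisfy this for all \<open>k\<close>, which allows one treatment of the
  three kinds of class.\<close>

definition regularity_ge :: "regularity \<Rightarrow> nat \<Rightarrow> bool" where
  "regularity_ge r k \<longleftrightarrow> (\<forall>n. r = Ck n \<longrightarrow> k \<le> n)"

lemma regularity_ge_drop: "regularity_ge r (k + j) \<Longrightarrow> regularity_ge (drop_reg r j) k"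
  by (cases r) (auto simp: regularity_ge_def)

lemma regularity_ge_le: "regularity_ge r k \<Longrightarrow> j \<le> k \<Longrightarrow> regularity_ge r j"
  by (auto simp: regularity_ge_def)

lemma drop_reg_drop_reg [simp]: "drop_reg (drop_reg r j) k = drop_reg r (j + k)"
  by (cases r) auto

text \<open>Splits every closure property into one about finite differentiability and one about
  power series. For \<open>Ck n\<close> the quantifier over \<open>k\<close> adds nothing, since C^n
  maps are C^k for k \<le> n.\<close>

lemma reg_on_iff:
  "reg_on r f U \<longleftrightarrow> (\<forall>k. regularity_ge r k \<longrightarrow> Ck_on k f U) \<and>
     (r = Comega \<longrightarrow> (\<forall>x\<in>U. locally_power_series f x))"
  by (cases r) (auto simp: reg_on_def regularity_ge_def intro: Ck_on_le)

lemma reg_on_imp_Ck_on: "reg_on r f U \<Longrightarrow> regularity_ge r k \<Longrightarrow> Ck_on k f U"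
  by (simp add: reg_on_iff)

lemma reg_on_drop_reg:
  assumes "reg_on r f U"
  shows "reg_on (drop_reg r k) f U"
proof (cases r)
  case (Ck n)
  then show ?thesis using assms Ck_on_le[of n f U "n - k"] by (simp add: reg_on_def)
qed (use assms in auto)

lemma reg_on_cong:
  assumes "open U" "\<And>x. x \<in> U \<Longrightarrow> f x = g x" "reg_on r f U"
  shows "reg_on r g U"
  using assms(3) Ck_on_cong[OF assms(1), of f g] locally_power_series_cong[OF assms(1), of _ f g]
  unfolding reg_on_iff by (simp add: assms(2))

lemma reg_on_mono: "reg_on r f U \<Longrightarrow> V \<subseteq> U \<Longrightarrow> reg_on r f V"
  unfolding reg_on_iff by (blast intro: Ck_on_subset)

lemma reg_on_add:
  assumes "open U" "reg_on r f U" "reg_on r g U"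
  shows "reg_on r (\<lambda>x. f x + g x) U"
  using assms(2,3) Ck_on_add[OF assms(1)] locally_power_series_add[of f _ g]
  unfolding reg_on_iff by blast

lemma reg_on_bounded_linear:
  assumes "open U" "bounded_linear T" "reg_on r f U"
  shows "reg_on r (\<lambda>x. T (f x)) U"
  using assms(3) Ck_on_bounded_linear[OF assms(1,2)] locally_power_series_bounded_linear[OF assms(2), of f]
  unfolding reg_on_iff by blast

lemma reg_on_bounded_bilinear:
  fixes f :: "'a::euclidean_space \<Rightarrow> 'b::euclidean_space" and g :: "'a \<Rightarrow> 'c::euclidean_space"
    and B :: "'b \<Rightarrow> 'c \<Rightarrow> 'd::banach"
  assumes "open U" "bounded_bilinear B" "reg_on r f U" "reg_on r g U"
  shows "reg_on r (\<lambda>x. B (f x) (g x)) U"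
  using assms(3,4) Ck_on_bounded_bilinear[OF assms(1,2), of _ f g]
    locally_power_series_bounded_bilinear[OF assms(2), of f _ g]
  unfolding reg_on_iff by blast

lemma reg_on_zero: "open U \<Longrightarrow> reg_on r (\<lambda>x. 0) U"
  unfolding reg_on_iff locally_power_series_iff
  by (auto intro: Ck_on_const intro!: exI[of _ "\<lambda>_. 0"] exI[of _ "1::real"])

lemma reg_on_sum:
  assumes "open U" "\<And>i. i \<in> I \<Longrightarrow> reg_on r (f i) U"
  shows "reg_on r (\<lambda>x. \<Sum>i\<in>I. f i x) U"
  using assms(2) by (induction I rule: infinite_finite_induct) (auto intro: reg_on_zero reg_on_add assms(1))

lemma reg_on_has_derivative:
  assumes "reg_on r f U" "regularity_ge r 1" "x \<in> U"
  shows "(f has_derivative frechet_derivative f (at x)) (at x)"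
  using Ck_on_has_derivative[OF reg_on_imp_Ck_on[OF assms(1,2)]] assms(3) by simp

lemma reg_on_frechet_derivative_Basis:
  fixes f :: "'a::euclidean_space \<Rightarrow> 'b::euclidean_space"
  assumes "open U" "reg_on r f U" "regularity_ge r 1" "e \<in> Basis"
  shows "reg_on (drop_reg r 1) (\<lambda>x. frechet_derivative f (at x) e) U"
proof -
  have "Ck_on k (\<lambda>x. frechet_derivative f (at x) e) U" if "regularity_ge (drop_reg r 1) k" for k
  proof -
    \<comment> \<open>Subtraction is truncated: \<open>drop_reg (Ck 0) 1\<close> is again
      \<open>Ck 0\<close>. The assumption \<open>regularity_ge r 1\<close> excludes this
      case.\<close>
    have "regularity_ge r (Suc k)"
      using that assms(3) by (cases r) (auto simp: regularity_ge_def)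
    then show ?thesis using reg_on_imp_Ck_on[OF assms(2)] Ck_on_frechet_derivative by blast
  qed
  moreover have "locally_power_series (\<lambda>x. frechet_derivative f (at x) e) x"
    if "drop_reg r 1 = Comega" "x \<in> U" for x
  proof (rule locally_power_series_frechet_derivative[OF assms(1) \<open>x \<in> U\<close> _ assms(4)])
    show "f differentiable (at y)" if "y \<in> U" for y
      using reg_on_has_derivative[OF assms(2,3) that] by (rule differentiableI)
    show "locally_power_series f x"
      using that assms(2) by (cases r) (auto simp: reg_on_def)
  qed
  ultimately show ?thesis unfolding reg_on_iff by blast
qed

text \<open>A direction that varies with the point is expanded in the standard basis, since power
  series were differentiated along basis vectors only.\<close>

lemma reg_on_frechet_derivative:
  fixes f :: "'a::euclidean_space \<Rightarrow> 'b::euclidean_space"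
  assumes "open U" "reg_on r f U" "regularity_ge r 1" "reg_on (drop_reg r 1) w U"
  shows "reg_on (drop_reg r 1) (\<lambda>x. frechet_derivative f (at x) (w x)) U"
proof (rule reg_on_cong[OF assms(1)])
  show "reg_on (drop_reg r 1) (\<lambda>x. \<Sum>e\<in>Basis. (w x \<bullet> e) *\<^sub>R frechet_derivative f (at x) e) U"
    by (intro reg_on_sum assms(1) reg_on_bounded_bilinear[OF _ bounded_bilinear_scaleR]
        reg_on_frechet_derivative_Basis assms(2,3)
        reg_on_bounded_linear[OF _ bounded_linear_inner_left assms(4)])
  fix x assume "x \<in> U"
  then interpret D: bounded_linear "frechet_derivative f (at x)"
    using reg_on_has_derivative[OF assms(2,3)] has_derivative_bounded_linear by blast
  show "(\<Sum>e\<in>Basis. (w x \<bullet> e) *\<^sub>R frechet_derivative f (at x) e) = frechet_derivative f (at x) (w x)"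
    by (simp flip: D.scaleR D.sum add: euclidean_representation)
qed

section \<open>Regularity and derivatives of maps known only on a subset of the ambient
  space\<close>

lemma reg_on_subset_drop_reg: "reg_on_subset r f V \<Longrightarrow> reg_on_subset (drop_reg r k) f V"
  unfolding reg_on_subset_def by (meson reg_on_drop_reg)

lemma reg_on_subset_Ck: "reg_on_subset r f V \<Longrightarrow> regularity_ge r k \<Longrightarrow> reg_on_subset (Ck k) f V"
  unfolding reg_on_subset_def reg_on_def[of "Ck k"] regularity.case by (meson reg_on_imp_Ck_on)

lemma reg_on_subset_bounded_linear:
  assumes "bounded_linear T" "reg_on_subset r f V"
  shows "reg_on_subset r (\<lambda>x. T (f x)) V"
  unfolding reg_on_subset_def
proof
  fix p assume "p \<in> V"
  then obtain U g where "open U" "p \<in> U" "reg_on r g U" "\<forall>x\<in>U \<inter> V. g x = f x"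
    using assms(2) unfolding reg_on_subset_def by blast
  then show "\<exists>U g. open U \<and> p \<in> U \<and> reg_on r g U \<and> (\<forall>x\<in>U \<inter> V. g x = T (f x))"
    using reg_on_bounded_linear[OF _ assms(1)] by (intro exI[of _ U] exI[of _ "\<lambda>x. T (g x)"]) auto
qed

lemma reg_on_subset_combine:
  fixes f :: "'a::euclidean_space \<Rightarrow> 'b::real_normed_vector" and g :: "'a \<Rightarrow> 'c::real_normed_vector"
  assumes "\<And>U (f :: 'a \<Rightarrow> 'b) (g :: 'a \<Rightarrow> 'c). open U \<Longrightarrow> reg_on r f U \<Longrightarrow> reg_on r g U \<Longrightarrow> reg_on r (\<lambda>x. B (f x) (g x)) U"
    and f: "reg_on_subset r f V" and g: "reg_on_subset r g V"
  shows "reg_on_subset r (\<lambda>x. B (f x) (g x)) V"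
  unfolding reg_on_subset_def
proof
  fix p assume "p \<in> V"
  obtain U f' where "open U" "p \<in> U" "reg_on r f' U" "\<forall>x\<in>U \<inter> V. f' x = f x"
    using f \<open>p \<in> V\<close> unfolding reg_on_subset_def by blast
  moreover obtain W g' where "open W" "p \<in> W" "reg_on r g' W" "\<forall>x\<in>W \<inter> V. g' x = g x"
    using g \<open>p \<in> V\<close> unfolding reg_on_subset_def by blast
  moreover from calculation have "reg_on r (\<lambda>x. B (f' x) (g' x)) (U \<inter> W)"
    by (intro assms(1) open_Int) (blast intro: reg_on_mono)+
  ultimately show "\<exists>U h. open U \<and> p \<in> U \<and> reg_on r h U \<and> (\<forall>x\<in>U \<inter> V. h x = B (f x) (g x))"
    by (intro exI[of _ "U \<inter> W"] exI[of _ "\<lambda>x. B (f' x) (g' x)"]) auto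
qed

lemma reg_on_subset_bounded_bilinear:
  fixes f :: "'a::euclidean_space \<Rightarrow> 'b::euclidean_space" and g :: "'a \<Rightarrow> 'c::euclidean_space"
    and B :: "'b \<Rightarrow> 'c \<Rightarrow> 'd::banach"
  assumes "bounded_bilinear B" "reg_on_subset r f V" "reg_on_subset r g V"
  shows "reg_on_subset r (\<lambda>x. B (f x) (g x)) V"
  using reg_on_bounded_bilinear[OF _ assms(1)] assms(2,3) by (rule reg_on_subset_combine)

lemma reg_on_subset_add:
  "reg_on_subset r f V \<Longrightarrow> reg_on_subset r g V \<Longrightarrow> reg_on_subset r (\<lambda>x. f x + g x) V"
  by (rule reg_on_subset_combine[OF reg_on_add])

lemma reg_on_subset_diff:
  assumes "reg_on_subset r f V" "reg_on_subset r g V"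
  shows "reg_on_subset r (\<lambda>x. f x - g x) V"
  using reg_on_subset_add[OF assms(1) reg_on_subset_bounded_linear[OF
      bounded_linear_minus[OF bounded_linear_ident] assms(2)]] by simp

text \<open>As \<open>V\<close> is relatively open, the neighbourhood can be cut down until it meets
  \<open>M\<close> inside \<open>V\<close>. The extension then agrees with \<open>f\<close> on all
  of \<open>M\<close> near \<open>p\<close>, and its derivative is a derivative of \<open>f\<close>
  within \<open>M\<close>.\<close>

lemma reg_on_subset_extension:
  fixes M :: "'a::euclidean_space set"
  assumes "reg_on_subset r f V" "openin (top_of_set M) V" "p \<in> V"
  obtains U g where "open U" "p \<in> U" "U \<inter> M \<subseteq> V" "reg_on r g U" "\<And>x. x \<in> U \<inter> M \<Longrightarrow> g x = f x"
proof -
  obtain S where S: "open S" "V = M \<inter> S" using assms(2) openin_open by blast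
  obtain U g where U: "open U" "p \<in> U" "reg_on r g U" "\<forall>x\<in>U \<inter> V. g x = f x"
    using assms(1,3) unfolding reg_on_subset_def by blast
  show ?thesis
    by (rule that[of "U \<inter> S" g]) (use U S assms(3) in \<open>auto intro: reg_on_mono\<close>)
qed

lemma has_derivative_restrict:
  assumes "(g has_derivative D) (at x)" "open U" "x \<in> U" "x \<in> M" "\<And>y. y \<in> U \<inter> M \<Longrightarrow> g y = f y"
  shows "(f has_derivative D) (at x within M)"
proof (rule has_derivative_transform_eventually[OF has_derivative_at_withinI[OF assms(1)]])
  show "\<forall>\<^sub>F y in at x within M. g y = f y"
    unfolding eventually_at_topological using assms(2,3,5) by blast
qed (use assms(3-5) in auto)

lemma reg_on_subset_has_derivative:
  assumes "reg_on_subset r f V" "openin (top_of_set M) V" "p \<in> V" "regularity_ge r 1"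
  obtains D where "(f has_derivative D) (at p within M)"
proof -
  obtain U g where U: "open U" "p \<in> U" "U \<inter> M \<subseteq> V" "reg_on r g U" "\<And>x. x \<in> U \<inter> M \<Longrightarrow> g x = f x"
    using reg_on_subset_extension[OF assms(1-3)] by blast
  have "p \<in> M" using assms(2,3) openin_imp_subset by blast
  then show ?thesis
    using that has_derivative_restrict[OF reg_on_has_derivative[OF U(4) assms(4) U(2)] U(1,2) _ U(5)] by blast
qed

text \<open>A derivative within \<open>M\<close> is only determined on the velocities of curves in \<open>M\<close>.\<close>

lemma has_vector_derivative_along_curve:
  assumes f: "(f has_derivative D) (at p within M)"
    and \<gamma>: "\<gamma> 0 = p" "\<forall>\<^sub>F t in at 0. \<gamma> t \<in> M" "(\<gamma> has_vector_derivative v) (at (0::real))"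
    and p: "p \<in> M"
  shows "((\<lambda>t. f (\<gamma> t)) has_vector_derivative D v) (at 0)"
proof -
  obtain d where d: "d > 0" "\<And>t. t \<noteq> 0 \<Longrightarrow> dist t 0 < d \<Longrightarrow> \<gamma> t \<in> M"
    using \<gamma>(2) unfolding eventually_at by auto
  have sub: "\<gamma> ` ball 0 d \<subseteq> M"
    using d \<gamma>(1) p by (metis (no_types, lifting) dist_commute image_subsetI mem_ball)
  have "(\<gamma> has_derivative (\<lambda>t. t *\<^sub>R v)) (at 0 within ball 0 d)"
    using \<gamma>(3) unfolding has_vector_derivative_def by (rule has_derivative_at_withinI)
  moreover have "(f has_derivative D) (at (\<gamma> 0) within \<gamma> ` ball 0 d)"
    using has_derivative_subset[OF f sub] \<gamma>(1) by simp
  ultimately have "((\<lambda>t. f (\<gamma> t)) has_derivative (\<lambda>t. D (t *\<^sub>R v))) (at 0 within ball 0 d)"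
    using diff_chain_within[of \<gamma> _ 0 "ball 0 d" f D] by (simp add: o_def)
  then have "((\<lambda>t. f (\<gamma> t)) has_derivative (\<lambda>t. D (t *\<^sub>R v))) (at 0)"
    using d(1) by (simp add: at_within_open[of _ "ball 0 d"])
  then show ?thesis
    unfolding has_vector_derivative_def
    by (simp add: linear_simps(5)[OF has_derivative_bounded_linear[OF f]])
qed

text \<open>Justifies the definite description: every candidate value is the velocity of
  \<open>f\<close> along one and the same curve.\<close>

lemma tangential_derivative_eq:
  assumes "(f has_derivative D) (at p within M)" "v \<in> tangent_space M p" "p \<in> M"
  shows "tangential_derivative M f p v = D v"
  unfolding tangential_derivative_def
proof (rule the_equality)
  show "\<exists>D'. (f has_derivative D') (at p within M) \<and> D v = D' v" using assms(1) by blast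
  fix w assume "\<exists>D'. (f has_derivative D') (at p within M) \<and> w = D' v"
  then obtain D' where D': "(f has_derivative D') (at p within M)" "w = D' v" by blast
  obtain \<gamma> where \<gamma>: "\<gamma> 0 = p" "\<forall>\<^sub>F t in at 0. \<gamma> t \<in> M" "(\<gamma> has_vector_derivative v) (at (0::real))"
    using assms(2) unfolding tangent_space_def by blast
  show "w = D v"
    using has_vector_derivative_along_curve[OF D'(1) \<gamma> assms(3)]
      has_vector_derivative_along_curve[OF assms(1) \<gamma> assms(3)] D'(2)
    by (metis vector_derivative_unique_at)
qed

text \<open>Local extensions of \<open>f\<close> and of \<open>X\<close> are differentiated in the
  ambient space. They are arbitrary off \<open>M\<close>, but at points of \<open>V\<close> the
  result depends only on \<open>f\<close> and on the tangent vector \<open>X p\<close>.\<close>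

lemma reg_on_subset_tangential_derivative:
  fixes f :: "'a::euclidean_space \<Rightarrow> 'b::euclidean_space"
  assumes f: "reg_on_subset r f V" and V: "openin (top_of_set M) V" and r: "regularity_ge r 1"
    and X: "reg_on_subset (drop_reg r 1) X V" "\<And>p. p \<in> V \<Longrightarrow> X p \<in> tangent_space M p"
  shows "reg_on_subset (drop_reg r 1) (\<lambda>p. tangential_derivative M f p (X p)) V"
  unfolding reg_on_subset_def
proof
  fix p assume p: "p \<in> V"
  obtain U g where U: "open U" "p \<in> U" "U \<inter> M \<subseteq> V" "reg_on r g U" "\<And>x. x \<in> U \<inter> M \<Longrightarrow> g x = f x"
    using reg_on_subset_extension[OF f V p] by blast
  obtain W h where W: "open W" "p \<in> W" "W \<inter> M \<subseteq> V" "reg_on (drop_reg r 1) h W"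
    "\<And>x. x \<in> W \<inter> M \<Longrightarrow> h x = X x"
    using reg_on_subset_extension[OF X(1) V p] by blast
  have "reg_on (drop_reg r 1) (\<lambda>x. frechet_derivative g (at x) (h x)) (U \<inter> W)"
    using U W r by (intro reg_on_frechet_derivative) (auto intro: reg_on_mono)
  moreover have "frechet_derivative g (at x) (h x) = tangential_derivative M f x (X x)"
    if "x \<in> U \<inter> W \<inter> V" for x
  proof -
    have x: "x \<in> U" "x \<in> W" "x \<in> V" "x \<in> M"
      using that openin_imp_subset[OF V] by auto
    have "(f has_derivative frechet_derivative g (at x)) (at x within M)"
      using has_derivative_restrict[OF reg_on_has_derivative[OF U(4) r x(1)] U(1) x(1,4) U(5)] by simp
    then show ?thesis using tangential_derivative_eq X(2) W(5) x by (metis IntI)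
  qed
  ultimately show "\<exists>U g. open U \<and> p \<in> U \<and> reg_on (drop_reg r 1) g U \<and>
      (\<forall>x\<in>U \<inter> V. g x = tangential_derivative M f x (X x))"
    using U W by (intro exI[of _ "U \<inter> W"] exI[of _ "\<lambda>x. frechet_derivative g (at x) (h x)"]) auto
qed

section \<open>Tangent spaces of embedded submanifolds\<close>

lemma mixed_difference:
  fixes f :: "'a::real_normed_vector \<Rightarrow> real"
  assumes F: "\<And>x. x \<in> U \<Longrightarrow> (f has_derivative F x) (at x)"
    and G: "\<And>x. x \<in> U \<Longrightarrow> ((\<lambda>x. F x u) has_derivative G x) (at x)"
    and "t > 0" and U: "\<And>a b. a \<in> {0..t} \<Longrightarrow> b \<in> {0..t} \<Longrightarrow> p + a *\<^sub>R u + b *\<^sub>R v \<in> U"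
  obtains a b where "a \<in> {0..t}" "b \<in> {0..t}"
    "f (p + t *\<^sub>R u + t *\<^sub>R v) - f (p + t *\<^sub>R u) - (f (p + t *\<^sub>R v) - f p) =
      t * t * G (p + a *\<^sub>R u + b *\<^sub>R v) v"
proof -
  have line: "((\<lambda>a. p + a *\<^sub>R u + b *\<^sub>R v) has_derivative (\<lambda>h. h *\<^sub>R u)) (at a within {0..t})"
    "((\<lambda>b. p + a *\<^sub>R u + b *\<^sub>R v) has_derivative (\<lambda>h. h *\<^sub>R v)) (at b within {0..t})" for a b
    by (auto intro!: derivative_eq_intros)
  have U0: "p + a *\<^sub>R u \<in> U" if "a \<in> {0..t}" for a using U[OF that, of 0] \<open>t > 0\<close> by simp
  have scale_F: "F x (h *\<^sub>R y) = h * F x y" if "x \<in> U" for x h y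
    using linear_simps(5)[OF has_derivative_bounded_linear[OF F[OF that]]] by simp
  have scale_G: "G x (h *\<^sub>R y) = h * G x y" if "x \<in> U" for x h y
    using linear_simps(5)[OF has_derivative_bounded_linear[OF G[OF that]]] by simp
  have line0: "((\<lambda>a. p + a *\<^sub>R u) has_derivative (\<lambda>h. h *\<^sub>R u)) (at a within {0..t})" for a
    by (auto intro!: derivative_eq_intros)
  have "((\<lambda>a. f (p + a *\<^sub>R u + t *\<^sub>R v) - f (p + a *\<^sub>R u)) has_derivative
      (\<lambda>h. F (p + a *\<^sub>R u + t *\<^sub>R v) (h *\<^sub>R u) - F (p + a *\<^sub>R u) (h *\<^sub>R u))) (at a within {0..t})"
    if "a \<in> {0..t}" for a
    using has_derivative_diff[OF has_derivative_compose[OF line(1) F[OF U]]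
        has_derivative_compose[OF line0 F[OF U0]]] that \<open>t > 0\<close> by simp
  from mvt_simple[OF \<open>t > 0\<close> this] obtain a where a': "0 < a" "a < t" and a_eq:
    "f (p + t *\<^sub>R u + t *\<^sub>R v) - f (p + t *\<^sub>R u) - (f (p + t *\<^sub>R v) - f p) =
       F (p + a *\<^sub>R u + t *\<^sub>R v) (t *\<^sub>R u) - F (p + a *\<^sub>R u) (t *\<^sub>R u)"
    by (simp add: Bex_def) blast
  with a' have a: "a \<in> {0..t}" by simp
  have "((\<lambda>b. F (p + a *\<^sub>R u + b *\<^sub>R v) u) has_derivative
      (\<lambda>h. G (p + a *\<^sub>R u + b *\<^sub>R v) (h *\<^sub>R v))) (at b within {0..t})"
    if "b \<in> {0..t}" for b
    by (rule has_derivative_compose[OF line(2) G[OF U]]) (use that a in auto)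
  from mvt_simple[OF \<open>t > 0\<close> this] obtain b where b': "0 < b" "b < t" and b_eq:
    "F (p + a *\<^sub>R u + t *\<^sub>R v) u - F (p + a *\<^sub>R u) u = G (p + a *\<^sub>R u + b *\<^sub>R v) (t *\<^sub>R v)"
    by (simp add: Bex_def) blast
  with b' have b: "b \<in> {0..t}" by simp
  show ?thesis
  proof (rule that[OF a b])
    have "F (p + a *\<^sub>R u + t *\<^sub>R v) (t *\<^sub>R u) - F (p + a *\<^sub>R u) (t *\<^sub>R u) =
        t * (F (p + a *\<^sub>R u + t *\<^sub>R v) u - F (p + a *\<^sub>R u) u)"
      using a \<open>t > 0\<close> by (simp add: scale_F U U0 right_diff_distrib)
    then show "f (p + t *\<^sub>R u + t *\<^sub>R v) - f (p + t *\<^sub>R u) - (f (p + t *\<^sub>R v) - f p) =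
      t * t * G (p + a *\<^sub>R u + b *\<^sub>R v) v"
      unfolding a_eq b_eq using a b by (simp add: scale_G U)
  qed
qed

text \<open>Schwarz's argument: the second difference over a small parallelogram does not change
  when \<open>u\<close> and \<open>v\<close> are exchanged. Two applications of the mean value
  theorem write it as t^2 times a second derivative at an intermediate point, once for each order.
  By continuity both values are within \<epsilon> of their values at \<open>p\<close>, which are 2
  \<epsilon> apart.\<close>

lemma second_derivative_symmetric_real:
  fixes f :: "'a::real_normed_vector \<Rightarrow> real"
  assumes "open U" "p \<in> U" and F: "\<And>x. x \<in> U \<Longrightarrow> (f has_derivative F x) (at x)"
    and G: "\<And>x. x \<in> U \<Longrightarrow> ((\<lambda>x. F x u) has_derivative G x) (at x)"
    and H: "\<And>x. x \<in> U \<Longrightarrow> ((\<lambda>x. F x v) has_derivative H x) (at x)"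
    and cont: "continuous_on U (\<lambda>x. G x v)" "continuous_on U (\<lambda>x. H x u)"
  shows "G p v = H p u"
proof (rule ccontr)
  assume neq: "G p v \<noteq> H p u"
  define \<epsilon> where "\<epsilon> = \<bar>G p v - H p u\<bar> / 2"
  have "\<epsilon> > 0" using neq by (simp add: \<epsilon>_def)
  have "isCont (\<lambda>x. G x v) p" "isCont (\<lambda>x. H x u) p"
    using cont assms(1,2) continuous_on_eq_continuous_at by blast+
  then obtain d\<^sub>1 d\<^sub>2 where d: "d\<^sub>1 > 0" "d\<^sub>2 > 0"
    "\<And>x. dist x p < d\<^sub>1 \<Longrightarrow> \<bar>G x v - G p v\<bar> < \<epsilon>" "\<And>x. dist x p < d\<^sub>2 \<Longrightarrow> \<bar>H x u - H p u\<bar> < \<epsilon>"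
    using \<open>\<epsilon> > 0\<close> unfolding continuous_at_eps_delta dist_real_def by metis
  obtain d\<^sub>3 where d3: "d\<^sub>3 > 0" "ball p d\<^sub>3 \<subseteq> U" using assms(1,2) openE by blast
  define d where "d = min d\<^sub>1 (min d\<^sub>2 d\<^sub>3)"
  \<comment> \<open>Puts the parallelogram within distance \<open>d\<close> of \<open>p\<close>; the
    summand 1 covers the case that \<open>u\<close> and \<open>v\<close> are both 0.\<close>
  define t where "t = d / (2 * (1 + norm u + norm v))"
  have "d > 0" using d(1,2) d3(1) by (simp add: d_def)
  then have "t > 0" unfolding t_def by (intro divide_pos_pos mult_pos_pos add_pos_nonneg) auto
  have t_le: "t * (norm u + norm v) < d"
  proof -
    have "t * (norm u + norm v) < t * (2 * (1 + norm u + norm v))"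
    proof (rule mult_strict_left_mono[OF _ \<open>t > 0\<close>])
      have "0 < norm v + (norm u + 2)" by (intro add_nonneg_pos) simp_all
      then show "norm u + norm v < 2 * (1 + norm u + norm v)" by simp
    qed
    also have "\<dots> = d"
    proof -
      have "1 + norm u + norm v > 0" by (intro add_pos_nonneg) auto
      then have "1 + norm u + norm v \<noteq> 0" by (rule less_imp_neq[symmetric])
      then show ?thesis unfolding t_def
        by (metis mult_eq_0_iff nonzero_divide_eq_eq zero_neq_numeral)
    qed
    finally show ?thesis .
  qed
  have near: "dist (p + a *\<^sub>R x + b *\<^sub>R y) p < d"
    if "a \<in> {0..t}" "b \<in> {0..t}" "norm x + norm y = norm u + norm v" for a b x y
  proof -
    have "dist (p + a *\<^sub>R x + b *\<^sub>R y) p \<le> norm (a *\<^sub>R x) + norm (b *\<^sub>R y)"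
      by (simp add: dist_norm add.assoc del: norm_scaleR) (rule norm_triangle_ineq)
    also have "\<dots> \<le> t * norm x + t * norm y"
      using that(1,2) by (auto intro!: add_mono mult_right_mono)
    also have "\<dots> < d" using t_le that(3) by (simp flip: distrib_left)
    finally show ?thesis .
  qed
  then have inU: "p + a *\<^sub>R x + b *\<^sub>R y \<in> U"
    if "a \<in> {0..t}" "b \<in> {0..t}" "norm x + norm y = norm u + norm v" for a b x y
    using that d3(2) by (auto simp: d_def dist_commute subset_iff)
  obtain a b where ab: "a \<in> {0..t}" "b \<in> {0..t}"
    "f (p + t *\<^sub>R u + t *\<^sub>R v) - f (p + t *\<^sub>R u) - (f (p + t *\<^sub>R v) - f p) =
      t * t * G (p + a *\<^sub>R u + b *\<^sub>R v) v"
    using mixed_difference[OF F G \<open>t > 0\<close> inU] by auto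
  obtain a' b' where ab': "a' \<in> {0..t}" "b' \<in> {0..t}"
    "f (p + t *\<^sub>R v + t *\<^sub>R u) - f (p + t *\<^sub>R v) - (f (p + t *\<^sub>R u) - f p) =
      t * t * H (p + a' *\<^sub>R v + b' *\<^sub>R u) u"
    using mixed_difference[OF F H \<open>t > 0\<close> inU] by (auto simp: add.commute)
  have "t * t * G (p + a *\<^sub>R u + b *\<^sub>R v) v = t * t * H (p + a' *\<^sub>R v + b' *\<^sub>R u) u"
    unfolding ab(3)[symmetric] ab'(3)[symmetric] by (simp add: algebra_simps)
  then have "G (p + a *\<^sub>R u + b *\<^sub>R v) v = H (p + a' *\<^sub>R v + b' *\<^sub>R u) u"
    using \<open>t > 0\<close> by simp
  moreover have "\<bar>G (p + a *\<^sub>R u + b *\<^sub>R v) v - G p v\<bar> < \<epsilon>"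
    using near[OF ab(1,2)] d(3) by (simp add: d_def)
  moreover have "\<bar>H (p + a' *\<^sub>R v + b' *\<^sub>R u) u - H p u\<bar> < \<epsilon>"
    using near[OF ab'(1,2)] d(4) by (simp add: d_def add.commute)
  ultimately show False
    using abs_triangle_half_l[of "G p v" "G (p + a *\<^sub>R u + b *\<^sub>R v) v" "2 * \<epsilon>" "H p u"]
    by (simp add: \<epsilon>_def abs_minus_commute)
qed

lemma second_derivative_symmetric:
  fixes f :: "'a::real_normed_vector \<Rightarrow> 'b::euclidean_space"
  assumes "open U" "p \<in> U" and f: "Ck_on 2 f U"
  shows "frechet_derivative (\<lambda>x. frechet_derivative f (at x) u) (at p) v =
    frechet_derivative (\<lambda>x. frechet_derivative f (at x) v) (at p) u"
proof (rule euclidean_eqI)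
  fix b :: 'b assume "b \<in> Basis"
  note inner = bounded_linear.has_derivative[OF bounded_linear_inner_left]
    and cont = continuous_on_inner[OF _ continuous_on_const]
  have f': "Ck_on (Suc 0) (\<lambda>x. frechet_derivative f (at x) w) U" for w
    using f by (simp add: numeral_2_eq_2)
  have f'': "continuous_on U (\<lambda>x. frechet_derivative (\<lambda>x. frechet_derivative f (at x) w) (at x) w')" for w w'
    using Ck_on_frechet_derivative[OF f'] by simp
  show "frechet_derivative (\<lambda>x. frechet_derivative f (at x) u) (at p) v \<bullet> b =
      frechet_derivative (\<lambda>x. frechet_derivative f (at x) v) (at p) u \<bullet> b"
    by (rule second_derivative_symmetric_real[OF assms(1,2) inner[OF Ck_on_has_derivative[OF f]]
          inner[OF Ck_on_Suc_has_derivative[OF f']] inner[OF Ck_on_Suc_has_derivative[OF f']]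
          cont[OF f''] cont[OF f'']]) simp_all
qed

section \<open>Tangent spaces in straightening charts, and tangency of commutators\<close>

lemma has_vector_derivative_in_subspace:
  fixes W :: "'a::euclidean_space set"
  assumes "subspace W" "\<forall>\<^sub>F t in at 0. c t \<in> W" "c 0 \<in> W" "(c has_vector_derivative w) (at (0::real))"
  shows "w \<in> W"
proof -
  \<comment> \<open>Pairing the curve with a normal \<open>n\<close> of \<open>W\<close> gives a
    function that vanishes near 0, so its derivative vanishes too; and \<open>W\<close> is its own
    double orthogonal complement.\<close>
  have "n \<bullet> w = 0" if n: "n \<in> W\<^sup>\<bottom>" for n
  proof -
    have orth: "n \<bullet> y = 0" if "y \<in> W" for y
      using n that by (auto simp: orthogonal_comp_def orthogonal_def inner_commute)
    have "((\<lambda>t. n \<bullet> c t) has_vector_derivative n \<bullet> w) (at 0)"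
      using bounded_linear.has_vector_derivative[OF bounded_linear_inner_right assms(4)] .
    moreover have "((\<lambda>t. n \<bullet> c t) has_vector_derivative 0) (at 0)"
      unfolding has_vector_derivative_def
      by (rule has_derivative_transform_eventually[of "\<lambda>t. 0"])
        (use assms(2,3) orth in \<open>auto elim: eventually_mono\<close>)
    ultimately show ?thesis by (rule vector_derivative_unique_at)
  qed
  then have "w \<in> W\<^sup>\<bottom>\<^sup>\<bottom>" by (auto simp: orthogonal_comp_def orthogonal_def)
  then show ?thesis using orthogonal_comp_self[OF assms(1)] by simp
qed

text \<open>\<open>D\<close> and \<open>E\<close> are inverse to each other because \<phi> and
  \<psi> are. Curves in \<open>M\<close> are carried by \<phi> into \<open>W\<close>, and short
  straight segments in \<open>W\<close> are carried back by \<psi> into \<open>M\<close>.\<close>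

lemma tangent_space_chart:
  fixes M :: "'a::euclidean_space set" and \<phi> \<psi> :: "'a \<Rightarrow> 'a"
  assumes U: "open U" "open U'" "p \<in> U" "p \<in> M" and W: "subspace W"
    and h: "homeomorphism U U' \<phi> \<psi>" and im: "\<phi> ` (U \<inter> M) = U' \<inter> W"
    and D: "(\<phi> has_derivative D) (at p)" and E: "(\<psi> has_derivative E) (at (\<phi> p))"
  shows "v \<in> tangent_space M p \<longleftrightarrow> D v \<in> W" "tangent_space M p = E ` W" "inj E"
proof -
  have inv: "\<psi> (\<phi> x) = x" if "x \<in> U" for x using h that by (simp add: homeomorphism_def)
  have inv': "\<phi> (\<psi> y) = y" if "y \<in> U'" for y using h that by (simp add: homeomorphism_def)
  have \<phi>p: "\<phi> p \<in> U'" "\<phi> p \<in> W" using im U(3,4) by auto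
  have ED: "E (D v) = v" for v
  proof -
    have "((\<lambda>x. x) has_derivative (\<lambda>v. E (D v))) (at p)"
      using has_derivative_compose[OF D E] U(1,3) inv
      by (rule has_derivative_transform_within_open) auto
    from has_derivative_unique[OF this has_derivative_ident] show ?thesis by metis
  qed
  have DE: "D (E w) = w" for w
  proof -
    have "(\<phi> has_derivative D) (at (\<psi> (\<phi> p)))" using D inv U(3) by simp
    from has_derivative_compose[OF E this]
    have "((\<lambda>y. y) has_derivative (\<lambda>w. D (E w))) (at (\<phi> p))"
      using U(2) \<phi>p(1) inv' by (rule has_derivative_transform_within_open) auto
    from has_derivative_unique[OF this has_derivative_ident] show ?thesis by metis
  qed
  have iff: "v \<in> tangent_space M p \<longleftrightarrow> D v \<in> W" for v
  proof
    assume "v \<in> tangent_space M p"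
    then obtain \<gamma> where \<gamma>: "\<gamma> 0 = p" "\<forall>\<^sub>F t in at 0. \<gamma> t \<in> M" "(\<gamma> has_vector_derivative v) (at (0::real))"
      unfolding tangent_space_def by blast
    have "(\<gamma> \<longlongrightarrow> p) (at 0)"
      using has_vector_derivative_continuous[OF \<gamma>(3)] \<gamma>(1) by (simp add: continuous_at)
    then have "\<forall>\<^sub>F t in at 0. \<gamma> t \<in> U" using U(1,3) topological_tendstoD by blast
    with \<gamma>(2) have "\<forall>\<^sub>F t in at 0. \<phi> (\<gamma> t) \<in> W"
      by eventually_elim (use im in blast)
    moreover have "((\<lambda>t. \<phi> (\<gamma> t)) has_vector_derivative D v) (at 0)"
      by (rule has_vector_derivative_along_curve[of _ _ p UNIV]) (use D \<gamma> in auto)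
    ultimately show "D v \<in> W"
      using has_vector_derivative_in_subspace[OF W, of "\<lambda>t. \<phi> (\<gamma> t)"] \<gamma>(1) \<phi>p(2) by simp
  next
    assume DW: "D v \<in> W"
    let ?l = "\<lambda>t::real. \<phi> p + t *\<^sub>R D v"
    have l: "(?l has_vector_derivative D v) (at 0)"
      by (auto simp: has_vector_derivative_def intro!: derivative_eq_intros)
    have "((\<lambda>t. \<psi> (?l t)) has_vector_derivative E (D v)) (at 0)"
      by (rule has_vector_derivative_along_curve[of _ _ "\<phi> p" UNIV]) (use E l in auto)
    moreover have "\<forall>\<^sub>F t in at 0. \<psi> (?l t) \<in> M"
    proof -
      have "(?l \<longlongrightarrow> \<phi> p) (at 0)"
        using has_vector_derivative_continuous[OF l] by (simp add: continuous_at)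
      then have "\<forall>\<^sub>F t in at 0. ?l t \<in> U'" using U(2) \<phi>p(1) topological_tendstoD by blast
      then show ?thesis
      proof eventually_elim
        fix t assume "?l t \<in> U'"
        moreover have "?l t \<in> W" using \<phi>p(2) DW W by (simp add: subspace_add subspace_scale)
        ultimately have "?l t \<in> \<phi> ` (U \<inter> M)" using im by blast
        then show "\<psi> (?l t) \<in> M" using inv by auto
      qed
    qed
    ultimately show "v \<in> tangent_space M p"
      unfolding tangent_space_def using inv[OF U(3)] ED
      by (auto intro!: exI[of _ "\<lambda>t. \<psi> (?l t)"])
  qed
  show "v \<in> tangent_space M p \<longleftrightarrow> D v \<in> W" by (rule iff)
  show "inj E" using DE by (rule inj_on_inverseI)
  show "tangent_space M p = E ` W"
  proof (intro subset_antisym subsetI)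
    fix v assume "v \<in> tangent_space M p"
    then show "v \<in> E ` W" using iff ED[of v] by (metis imageI)
  next
    fix v assume "v \<in> E ` W"
    then show "v \<in> tangent_space M p" using iff DE by auto
  qed
qed

text \<open>A single chart serves all points of \<open>M\<close> near \<open>p\<close>. The tangency
  condition d\<phi>(v) \<in> W will be differentiated along \<open>M\<close>, for which a separate
  chart at each point would not do.\<close>

lemma embedded_submanifold_chart:
  fixes M :: "'a::euclidean_space set"
  assumes "embedded_submanifold r d M" "p \<in> M" "regularity_ge r 1"
  obtains U U' W and \<phi> \<psi> :: "'a \<Rightarrow> 'a" where "open U" "p \<in> U" "open U'" "subspace W" "dim W = d"
    "homeomorphism U U' \<phi> \<psi>" "reg_on r \<phi> U" "\<phi> ` (U \<inter> M) = U' \<inter> W"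
    "\<And>x v. x \<in> U \<inter> M \<Longrightarrow> v \<in> tangent_space M x \<longleftrightarrow> frechet_derivative \<phi> (at x) v \<in> W"
    "\<And>x. x \<in> U \<inter> M \<Longrightarrow> subspace (tangent_space M x) \<and> dim (tangent_space M x) = d"
proof -
  obtain U U' W and \<phi> \<psi> :: "'a \<Rightarrow> 'a" where c: "open U" "p \<in> U" "open U'" "subspace W" "dim W = d"
    "homeomorphism U U' \<phi> \<psi>" "reg_on r \<phi> U" "reg_on r \<psi> U'" "\<phi> ` (U \<inter> M) = U' \<inter> W"
    using bspec[OF assms(1)[unfolded embedded_submanifold_def] assms(2)] by (elim exE conjE) (rule that)
  show ?thesis
  proof (rule that[OF c(1-7,9)])
    fix x assume x: "x \<in> U \<inter> M"
    then have "\<phi> x \<in> U'" using c(9) by blast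
    note chart = tangent_space_chart[OF c(1,3) _ _ c(4,6,9)
        reg_on_has_derivative[OF c(7) assms(3)] reg_on_has_derivative[OF c(8) assms(3) this]]
    show "v \<in> tangent_space M x \<longleftrightarrow> frechet_derivative \<phi> (at x) v \<in> W" for v
      using chart(1) x by blast
    have "linear (frechet_derivative \<psi> (at (\<phi> x)))"
      using reg_on_has_derivative[OF c(8) assms(3) \<open>\<phi> x \<in> U'\<close>] has_derivative_linear by blast
    then show "subspace (tangent_space M x) \<and> dim (tangent_space M x) = d"
      using chart(2,3) x c(4,5) by (auto simp: linear_subspace_image dim_image_eq inj_on_subset)
  qed
qed

lemma
  assumes "embedded_submanifold r d M" "p \<in> M" "regularity_ge r 1"
  shows subspace_tangent_space: "subspace (tangent_space M p)"
    and dim_tangent_space: "dim (tangent_space M p) = d"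
  using embedded_submanifold_chart[OF assms] assms(2) by (metis IntI)+

text \<open>In a chart \<open>\<phi>\<close> that straightens \<open>M\<close> to \<open>W\<close>, the field \<open>d\<phi>(Y)\<close> takes values in \<open>W\<close>, hence so does
  its derivative \<open>d\<^sup>2\<phi>(X, Y) + d\<phi>(dY(X))\<close> along \<open>X\<close>; the symmetric term drops out of the commutator.\<close>

lemma commutator_tangent:
  fixes M :: "'a::euclidean_space set"
  assumes M: "embedded_submanifold r d M" "regularity_ge r 2"
    and V: "openin (top_of_set M) V" "p \<in> V"
    and tan: "\<And>x. x \<in> V \<Longrightarrow> X x \<in> tangent_space M x" "\<And>x. x \<in> V \<Longrightarrow> Y x \<in> tangent_space M x"
    and DX: "(X has_derivative DX) (at p within M)" and DY: "(Y has_derivative DY) (at p within M)"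
  shows "DY (X p) - DX (Y p) \<in> tangent_space M p"
proof -
  have r1: "regularity_ge r 1" using M(2) regularity_ge_le one_le_numeral by blast
  have pM: "p \<in> M" using V openin_imp_subset by blast
  obtain U U' W and \<phi> \<psi> :: "'a \<Rightarrow> 'a" where c: "open U" "p \<in> U" "open U'" "subspace W" "dim W = d"
    "homeomorphism U U' \<phi> \<psi>" "reg_on r \<phi> U" "\<phi> ` (U \<inter> M) = U' \<inter> W"
    and tan_iff: "\<And>x v. x \<in> U \<inter> M \<Longrightarrow> v \<in> tangent_space M x \<longleftrightarrow> frechet_derivative \<phi> (at x) v \<in> W"
    using embedded_submanifold_chart[OF M(1) pM r1] by metis
  define F where "F x v = frechet_derivative \<phi> (at x) v" for x v
  define K where "K v h = frechet_derivative (\<lambda>x. F x v) (at p) h" for v h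
  have C2: "Ck_on 2 \<phi> U" using reg_on_imp_Ck_on[OF c(7) M(2)] .
  have F: "linear (F x)" if "x \<in> U" for x
    using has_derivative_linear[OF Ck_on_has_derivative[OF C2 _ that]] by (simp add: F_def[abs_def])
  have K: "((\<lambda>x. F x v) has_derivative K v) (at p)" for v
    using Ck_on_Suc_has_derivative[OF Ck_on_frechet_derivative, of 0 \<phi> U p v] C2 c(2)
    by (simp add: F_def[abs_def] K_def[abs_def] numeral_2_eq_2)
  \<comment> \<open>The derivative of \<open>F x v\<close> in \<open>x\<close> is known for fixed
    \<open>v\<close> only. Expanding \<open>v\<close> in the basis reduces F x (Z x) to finitely
    many products.\<close>
  have F_expand: "F x v = (\<Sum>b\<in>Basis. (v \<bullet> b) *\<^sub>R F x b)" if "x \<in> U" for x v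
    by (simp flip: linear_scale[OF F[OF that]] linear_sum[OF F[OF that]] add: euclidean_representation)
  have K_expand: "K v h = (\<Sum>b\<in>Basis. (v \<bullet> b) *\<^sub>R K b h)" for v h
  proof -
    have "((\<lambda>x. \<Sum>b\<in>Basis. (v \<bullet> b) *\<^sub>R F x b) has_derivative (\<lambda>h. \<Sum>b\<in>Basis. (v \<bullet> b) *\<^sub>R K b h)) (at p)"
      by (intro has_derivative_sum has_derivative_scaleR_right K)
    then have "((\<lambda>x. F x v) has_derivative (\<lambda>h. \<Sum>b\<in>Basis. (v \<bullet> b) *\<^sub>R K b h)) (at p)"
      using c(1,2) F_expand[symmetric] by (rule has_derivative_transform_within_open)
    from has_derivative_unique[OF K this] show ?thesis by metis
  qed
  have *: "K (Z p) (X p) + F p (DZ (X p)) \<in> W"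
    if X: "\<And>x. x \<in> V \<Longrightarrow> X x \<in> tangent_space M x" and Z: "\<And>x. x \<in> V \<Longrightarrow> Z x \<in> tangent_space M x"
      and DZ: "(Z has_derivative DZ) (at p within M)" for X Z DZ
  proof -
    have "((\<lambda>x. (Z x \<bullet> b) *\<^sub>R F x b) has_derivative
        (\<lambda>h. (Z p \<bullet> b) *\<^sub>R K b h + (DZ h \<bullet> b) *\<^sub>R F p b)) (at p within M)" for b
      by (rule has_derivative_scaleR[OF bounded_linear.has_derivative[OF bounded_linear_inner_left DZ]
            has_derivative_at_withinI[OF K]])
    then have "((\<lambda>x. \<Sum>b\<in>Basis. (Z x \<bullet> b) *\<^sub>R F x b) has_derivative
        (\<lambda>h. \<Sum>b\<in>Basis. (Z p \<bullet> b) *\<^sub>R K b h + (DZ h \<bullet> b) *\<^sub>R F p b)) (at p within M)"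
      by (intro has_derivative_sum)
    moreover have "(\<lambda>h. \<Sum>b\<in>Basis. (Z p \<bullet> b) *\<^sub>R K b h + (DZ h \<bullet> b) *\<^sub>R F p b) =
        (\<lambda>h. K (Z p) h + F p (DZ h))"
      unfolding K_expand[of "Z p"] F_expand[OF c(2), of "DZ _"] by (simp add: sum.distrib)
    ultimately have deriv: "((\<lambda>x. F x (Z x)) has_derivative (\<lambda>h. K (Z p) h + F p (DZ h))) (at p within M)"
      by (simp add: has_derivative_transform_within_open[OF _ c(1,2) F_expand[symmetric]])
    \<comment> \<open>The field \<phi>-image is differentiated along a curve in \<open>M\<close>
      with velocity \<open>X p\<close>. For small times the curve stays in the chart and in
      \<open>V\<close>, where the image of \<open>Z\<close> lies in \<open>W\<close>.\<close>
    obtain \<gamma> where \<gamma>: "\<gamma> 0 = p" "\<forall>\<^sub>F t in at 0. \<gamma> t \<in> M" "(\<gamma> has_vector_derivative X p) (at (0::real))"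
      using X[OF V(2)] unfolding tangent_space_def by blast
    obtain S where S: "open S" "V = M \<inter> S" using V(1) openin_open by blast
    have "(\<gamma> \<longlongrightarrow> p) (at 0)"
      using has_vector_derivative_continuous[OF \<gamma>(3)] \<gamma>(1) by (simp add: continuous_at)
    then have "\<forall>\<^sub>F t in at 0. \<gamma> t \<in> U \<inter> S"
      using topological_tendstoD[of \<gamma> p "at 0" "U \<inter> S"] c(1,2) S V(2) by auto
    with \<gamma>(2) have "\<forall>\<^sub>F t in at 0. F (\<gamma> t) (Z (\<gamma> t)) \<in> W"
      by eventually_elim (use S(2) Z tan_iff in \<open>auto simp: F_def\<close>)
    moreover have "F (\<gamma> 0) (Z (\<gamma> 0)) \<in> W"
      using \<gamma>(1) Z[OF V(2)] tan_iff c(2) pM by (auto simp: F_def)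
    ultimately show ?thesis
      using has_vector_derivative_in_subspace[OF c(4) _ _ has_vector_derivative_along_curve[OF deriv \<gamma> pM]]
      by blast
  qed
  have "K (Y p) (X p) = K (X p) (Y p)"
    unfolding K_def F_def by (rule second_derivative_symmetric[OF c(1,2) C2])
  then have "F p (DY (X p)) - F p (DX (Y p)) \<in> W"
    using subspace_diff[OF c(4) *[OF tan DY] *[OF tan(2,1) DX]] by simp
  then have "F p (DY (X p) - DX (Y p)) \<in> W" using F[OF c(2)] by (simp add: linear_diff)
  then show ?thesis using tan_iff c(2) pM by (simp add: F_def)
qed

section \<open>Complex vector fields and their brackets\<close>

lemma bounded_bilinear_cscale:
  "bounded_bilinear (cscale :: complex \<Rightarrow> 'a::euclidean_space complexified \<Rightarrow> 'a complexified)"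
  unfolding bilinear_conv_bounded_bilinear[symmetric] bilinear_def
  by (auto intro!: linearI simp: cscale_def algebra_simps)

lemmas bounded_linear_cscale = bounded_bilinear.bounded_linear_right[OF bounded_bilinear_cscale]

lemma bounded_linear_cconj: "bounded_linear (cconj :: 'a::euclidean_space complexified \<Rightarrow> _)"
  unfolding linear_conv_bounded_linear[symmetric]
  by (auto intro!: linearI simp: cconj_def algebra_simps)

lemma cconj_cconj [simp]: "cconj (cconj X) = X"
  by (simp add: cconj_def)

lemma cconj_cscale: "cconj (cscale z X) = cscale (cnj z) (cconj X)"
  by (simp add: cconj_def cscale_def)

lemma cconj_add: "cconj (X + Y) = cconj X + cconj Y"
  by (simp add: cconj_def)

lemma cconj_diff: "cconj (X - Y) = cconj X - cconj Y"
  by (simp add: cconj_def)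

lemma cscale_minus_left: "cscale (- z) X = - cscale z X"
  by (simp add: cscale_def)

lemma cconj_in_ctangent: "subspace (tangent_space M p) \<Longrightarrow> X \<in> ctangent M p \<Longrightarrow> cconj X \<in> ctangent M p"
  by (auto simp: cconj_def ctangent_def subspace_neg)

lemma cscale_in_ctangent: "subspace (tangent_space M p) \<Longrightarrow> X \<in> ctangent M p \<Longrightarrow> cscale z X \<in> ctangent M p"
  by (auto simp: cscale_def ctangent_def intro!: subspace_add subspace_diff subspace_scale)

lemma add_in_ctangent:
  "subspace (tangent_space M p) \<Longrightarrow> X \<in> ctangent M p \<Longrightarrow> Y \<in> ctangent M p \<Longrightarrow> X + Y \<in> ctangent M p"
  by (auto simp: ctangent_def subspace_add)

text \<open>The derivative X(a) for a complex tangent vector: complex-linear in \<open>X\<close>,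
  with the formal \<open>\<i>\<close> of the complexification acting as multiplication on the
  values.\<close>

definition scalar_derivative ::
    "'a::real_normed_vector set \<Rightarrow> ('a \<Rightarrow> complex) \<Rightarrow> 'a \<Rightarrow> 'a complexified \<Rightarrow> complex" where
  "scalar_derivative M a p X = tangential_derivative M a p (fst X) + \<i> * tangential_derivative M a p (snd X)"

lemma cderivative_eq:
  assumes "(Y has_derivative D) (at p within M)" "X \<in> ctangent M p" "p \<in> M"
  shows "cderivative M Y p X = D (fst X) + cscale \<i> (D (snd X))"
  using assms(2) tangential_derivative_eq[OF assms(1) _ assms(3)]
  by (auto simp: cderivative_def ctangent_def)

lemma scalar_derivative_eq:
  assumes "(a has_derivative D) (at p within M)" "X \<in> ctangent M p" "p \<in> M"
  shows "scalar_derivative M a p X = D (fst X) + \<i> * D (snd X)"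
  using assms(2) tangential_derivative_eq[OF assms(1) _ assms(3)]
  by (auto simp: scalar_derivative_def ctangent_def)

context
  fixes M :: "'a::euclidean_space set" and p :: 'a
  assumes p: "p \<in> M"
begin

lemma cderivative_add:
  assumes "Y differentiable (at p within M)" "Z differentiable (at p within M)" "X \<in> ctangent M p"
  shows "cderivative M (\<lambda>q. Y q + Z q) p X = cderivative M Y p X + cderivative M Z p X"
proof -
  obtain DY DZ where D: "(Y has_derivative DY) (at p within M)" "(Z has_derivative DZ) (at p within M)"
    using assms(1,2) by (auto simp: differentiable_def)
  show ?thesis
    by (simp add: cderivative_eq[OF has_derivative_add[OF D] assms(3) p]
        cderivative_eq[OF D(1) assms(3) p] cderivative_eq[OF D(2) assms(3) p] cscale_def algebra_simps)
qed

lemma cderivative_cscale: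
  assumes "a differentiable (at p within M)" "Y differentiable (at p within M)" "X \<in> ctangent M p"
  shows "cderivative M (\<lambda>q. cscale (a q) (Y q)) p X =
    cscale (a p) (cderivative M Y p X) + cscale (scalar_derivative M a p X) (Y p)"
proof -
  obtain Da DY where D: "(a has_derivative Da) (at p within M)" "(Y has_derivative DY) (at p within M)"
    using assms(1,2) by (auto simp: differentiable_def)
  show ?thesis
    unfolding cderivative_eq[OF bounded_bilinear.FDERIV[OF bounded_bilinear_cscale D] assms(3) p]
      cderivative_eq[OF D(2) assms(3) p] scalar_derivative_eq[OF D(1) assms(3) p]
    by (simp add: cscale_def algebra_simps)
qed

lemma cderivative_cscale_const:
  assumes "Y differentiable (at p within M)" "X \<in> ctangent M p"
  shows "cderivative M (\<lambda>q. cscale z (Y q)) p X = cscale z (cderivative M Y p X)"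
  using assms(1) unfolding differentiable_def
proof
  fix D assume D: "(Y has_derivative D) (at p within M)"
  show ?thesis
    unfolding cderivative_eq[OF bounded_linear.has_derivative[OF bounded_linear_cscale D] assms(2) p]
      cderivative_eq[OF D assms(2) p]
    by (simp add: cplx.scale_right_distrib mult.commute)
qed

lemma lie_bracket_add_right:
  assumes "Y differentiable (at p within M)" "Z differentiable (at p within M)"
    "X differentiable (at p within M)" "X p \<in> ctangent M p" "Y p \<in> ctangent M p" "Z p \<in> ctangent M p"
    "subspace (tangent_space M p)"
  shows "lie_bracket M X (\<lambda>q. Y q + Z q) p = lie_bracket M X Y p + lie_bracket M X Z p"
proof -
  obtain D where D: "(X has_derivative D) (at p within M)"
    using assms(3) by (auto simp: differentiable_def)
  note eq = cderivative_eq[OF D _ p]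
  show ?thesis
    using add_in_ctangent[OF assms(7,5,6)] assms
    by (simp add: lie_bracket_def cderivative_add eq linear_simps(1)[OF has_derivative_bounded_linear[OF D]]
        cscale_def)
qed

lemma cderivative_cscale_arg:
  assumes "Y differentiable (at p within M)" "X \<in> ctangent M p" "subspace (tangent_space M p)"
  shows "cderivative M Y p (cscale z X) = cscale z (cderivative M Y p X)"
proof -
  obtain D where D: "(Y has_derivative D) (at p within M)"
    using assms(1) by (auto simp: differentiable_def)
  interpret D: bounded_linear D by (rule has_derivative_bounded_linear[OF D])
  show ?thesis
    unfolding cderivative_eq[OF D assms(2) p] cderivative_eq[OF D cscale_in_ctangent[OF assms(3,2)] p]
    by (simp add: D.add D.diff D.scaleR cscale_def prod_eq_iff algebra_simps)
qed

lemma scalar_derivative_cscale_arg: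
  assumes "a differentiable (at p within M)" "X \<in> ctangent M p" "subspace (tangent_space M p)"
  shows "scalar_derivative M a p (cscale z X) = z * scalar_derivative M a p X"
proof -
  obtain D where D: "(a has_derivative D) (at p within M)"
    using assms(1) by (auto simp: differentiable_def)
  interpret D: bounded_linear D by (rule has_derivative_bounded_linear[OF D])
  show ?thesis
    using assms(2) cscale_in_ctangent[OF assms(3,2)]
    by (simp add: scalar_derivative_eq[OF D _ p] D.add D.diff D.scaleR cscale_def complex_eq_iff algebra_simps)
qed

lemma cderivative_cconj:
  assumes "Y differentiable (at p within M)" "X \<in> ctangent M p" "subspace (tangent_space M p)"
  shows "cderivative M (\<lambda>q. cconj (Y q)) p (cconj X) = cconj (cderivative M Y p X)"
proof -
  obtain D where D: "(Y has_derivative D) (at p within M)"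
    using assms(1) by (auto simp: differentiable_def)
  interpret D: bounded_linear D by (rule has_derivative_bounded_linear[OF D])
  show ?thesis
    unfolding cderivative_eq[OF D assms(2) p] cderivative_eq[OF
        bounded_linear.has_derivative[OF bounded_linear_cconj D] cconj_in_ctangent[OF assms(3,2)] p]
    by (simp add: D.neg cconj_def cscale_def)
qed

lemma scalar_derivative_cnj:
  assumes "a differentiable (at p within M)" "X \<in> ctangent M p" "subspace (tangent_space M p)"
  shows "scalar_derivative M (\<lambda>q. cnj (a q)) p (cconj X) = cnj (scalar_derivative M a p X)"
proof -
  obtain D where D: "(a has_derivative D) (at p within M)"
    using assms(1) by (auto simp: differentiable_def)
  interpret D: bounded_linear D by (rule has_derivative_bounded_linear[OF D])
  show ?thesis
    using assms(2) cconj_in_ctangent[OF assms(3,2)]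
    by (simp add: scalar_derivative_eq[OF bounded_linear.has_derivative[OF bounded_linear_cnj D] _ p]
        scalar_derivative_eq[OF D _ p] D.neg cconj_def)
qed

lemma lie_bracket_cconj:
  assumes "X differentiable (at p within M)" "Y differentiable (at p within M)"
    "X p \<in> ctangent M p" "Y p \<in> ctangent M p" "subspace (tangent_space M p)"
  shows "lie_bracket M (\<lambda>q. cconj (X q)) (\<lambda>q. cconj (Y q)) p = cconj (lie_bracket M X Y p)"
  using assms by (simp add: lie_bracket_def cderivative_cconj cconj_diff)

text \<open>The Leibniz rule from which both transformation formulas, for T and for S, are
  computed.\<close>

lemma lie_bracket_cscale:
  assumes "a differentiable (at p within M)" "b differentiable (at p within M)"
    "X differentiable (at p within M)" "Y differentiable (at p within M)"
    "X p \<in> ctangent M p" "Y p \<in> ctangent M p" "subspace (tangent_space M p)"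
  shows "lie_bracket M (\<lambda>q. cscale (a q) (X q)) (\<lambda>q. cscale (b q) (Y q)) p =
    cscale (a p * b p) (lie_bracket M X Y p) + cscale (a p * scalar_derivative M b p (X p)) (Y p)
      - cscale (b p * scalar_derivative M a p (Y p)) (X p)"
  using assms
  by (simp add: lie_bracket_def cderivative_cscale cscale_in_ctangent cderivative_cscale_arg
      scalar_derivative_cscale_arg cplx.scale_right_diff_distrib algebra_simps)

lemma lie_bracket_cscale_const_right:
  assumes "X differentiable (at p within M)" "Y differentiable (at p within M)"
    "X p \<in> ctangent M p" "Y p \<in> ctangent M p" "subspace (tangent_space M p)"
  shows "lie_bracket M X (\<lambda>q. cscale z (Y q)) p = cscale z (lie_bracket M X Y p)"
  using assms by (simp add: lie_bracket_def cderivative_cscale_const cderivative_cscale_arg cplx.scale_right_diff_distrib)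

end

lemma lie_bracket_anticomm: "lie_bracket M Y X p = - lie_bracket M X Y p"
  by (simp add: lie_bracket_def)

lemma lie_bracket_self: "lie_bracket M X X p = 0"
  by (simp add: lie_bracket_def)

lemma tangential_derivative_cong:
  assumes "openin (top_of_set M) V" "p \<in> V" "\<And>x. x \<in> V \<Longrightarrow> f x = g x"
  shows "tangential_derivative M f p v = tangential_derivative M g p v"
proof -
  obtain S where S: "open S" "V = M \<inter> S" using assms(1) openin_open by blast
  have *: "(h' has_derivative D) (at p within M)"
    if "(h has_derivative D) (at p within M)" "\<And>x. x \<in> V \<Longrightarrow> h x = h' x" for h h' :: "'a \<Rightarrow> 'b" and D
  proof (rule has_derivative_transform_eventually[OF that(1)])
    show "\<forall>\<^sub>F x in at p within M. h x = h' x"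
      unfolding eventually_at_topological using S assms(2) that(2) by blast
  qed (use that(2) assms(2) S in auto)
  have "(f has_derivative D) (at p within M) \<longleftrightarrow> (g has_derivative D) (at p within M)" for D
    using *[of f D g] *[of g D f] assms(3) by auto
  then show ?thesis by (simp add: tangential_derivative_def)
qed

text \<open>Relations between two generators hold only on \<open>V\<close>; brackets are local, so
  such relations may be substituted inside them.\<close>

lemma lie_bracket_cong:
  assumes "openin (top_of_set M) V" "p \<in> V" "\<And>x. x \<in> V \<Longrightarrow> X x = X' x" "\<And>x. x \<in> V \<Longrightarrow> Y x = Y' x"
  shows "lie_bracket M X Y p = lie_bracket M X' Y' p"
  using assms(2-4) tangential_derivative_cong[OF assms(1,2,3)] tangential_derivative_cong[OF assms(1,2,4)]
  by (simp add: lie_bracket_def cderivative_def)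

text \<open>Splits into four real commutators: the real part is [fst X, fst Y] - [snd X, snd Y], the
  imaginary part is [fst X, snd Y] + [snd X, fst Y].\<close>

lemma lie_bracket_in_ctangent:
  fixes M :: "'a::euclidean_space set"
  assumes M: "embedded_submanifold r d M" "regularity_ge r 2"
    and V: "openin (top_of_set M) V" "p \<in> V"
    and X: "\<And>x. x \<in> V \<Longrightarrow> X x \<in> ctangent M x" "X differentiable (at p within M)"
    and Y: "\<And>x. x \<in> V \<Longrightarrow> Y x \<in> ctangent M x" "Y differentiable (at p within M)"
  shows "lie_bracket M X Y p \<in> ctangent M p"
proof -
  have pM: "p \<in> M" using V openin_imp_subset by blast
  have sub: "subspace (tangent_space M p)"
    using subspace_tangent_space[OF M(1) pM] M(2) regularity_ge_le by (metis one_le_numeral)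
  obtain DX DY where D: "(X has_derivative DX) (at p within M)" "(Y has_derivative DY) (at p within M)"
    using X(2) Y(2) by (auto simp: differentiable_def)
  note DX = bounded_linear.has_derivative[OF bounded_linear_fst D(1)] bounded_linear.has_derivative[OF bounded_linear_snd D(1)]
  note DY = bounded_linear.has_derivative[OF bounded_linear_fst D(2)] bounded_linear.has_derivative[OF bounded_linear_snd D(2)]
  have tan: "fst (X x) \<in> tangent_space M x" "snd (X x) \<in> tangent_space M x"
    "fst (Y x) \<in> tangent_space M x" "snd (Y x) \<in> tangent_space M x" if "x \<in> V" for x
    using X(1)[OF that] Y(1)[OF that] by (auto simp: ctangent_def)
  note comm = commutator_tangent[OF M V]
  have "(fst (DY (fst (X p))) - fst (DX (fst (Y p)))) - (snd (DY (snd (X p))) - snd (DX (snd (Y p)))) \<in> tangent_space M p"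
    by (rule subspace_diff[OF sub comm[OF tan(1,3) DX(1) DY(1)] comm[OF tan(2,4) DX(2) DY(2)]])
  moreover have "(snd (DY (fst (X p))) - fst (DX (snd (Y p)))) + (fst (DY (snd (X p))) - snd (DX (fst (Y p)))) \<in> tangent_space M p"
    by (rule subspace_add[OF sub comm[OF tan(1,4) DX(1) DY(2)] comm[OF tan(2,3) DX(2) DY(1)]])
  ultimately show ?thesis
    by (simp add: lie_bracket_def cderivative_eq[OF D(1) Y(1)[OF V(2)] pM]
        cderivative_eq[OF D(2) X(1)[OF V(2)] pM] ctangent_def mem_Times_iff cscale_def algebra_simps)
qed

lemma reg_on_subset_cderivative:
  fixes M :: "'a::euclidean_space set"
  assumes Y: "reg_on_subset r Y V" and V: "openin (top_of_set M) V" and r: "regularity_ge r 1"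
    and X: "reg_on_subset (drop_reg r 1) X V" "\<And>p. p \<in> V \<Longrightarrow> X p \<in> ctangent M p"
  shows "reg_on_subset (drop_reg r 1) (\<lambda>p. cderivative M Y p (X p)) V"
  unfolding cderivative_def using X(2)
  by (intro reg_on_subset_add reg_on_subset_bounded_linear[OF bounded_linear_cscale]
      reg_on_subset_tangential_derivative[OF Y V r]
      reg_on_subset_bounded_linear[OF bounded_linear_fst] reg_on_subset_bounded_linear[OF bounded_linear_snd]
      X(1)) (auto simp: ctangent_def mem_Times_iff)

lemma reg_on_subset_scalar_derivative:
  fixes M :: "'a::euclidean_space set"
  assumes a: "reg_on_subset r a V" and V: "openin (top_of_set M) V" and r: "regularity_ge r 1"
    and X: "reg_on_subset (drop_reg r 1) X V" "\<And>p. p \<in> V \<Longrightarrow> X p \<in> ctangent M p"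
  shows "reg_on_subset (drop_reg r 1) (\<lambda>p. scalar_derivative M a p (X p)) V"
  unfolding scalar_derivative_def using X(2)
  by (intro reg_on_subset_add reg_on_subset_bounded_linear[OF bounded_linear_mult_right]
      reg_on_subset_tangential_derivative[OF a V r]
      reg_on_subset_bounded_linear[OF bounded_linear_fst] reg_on_subset_bounded_linear[OF bounded_linear_snd]
      X(1)) (auto simp: ctangent_def mem_Times_iff)

lemma reg_on_subset_lie_bracket:
  fixes M :: "'a::euclidean_space set"
  assumes V: "openin (top_of_set M) V" and r: "regularity_ge r 1"
    and X: "reg_on_subset r X V" "\<And>p. p \<in> V \<Longrightarrow> X p \<in> ctangent M p"
    and Y: "reg_on_subset r Y V" "\<And>p. p \<in> V \<Longrightarrow> Y p \<in> ctangent M p"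
  shows "reg_on_subset (drop_reg r 1) (lie_bracket M X Y) V"
  unfolding lie_bracket_def[abs_def]
  by (intro reg_on_subset_diff reg_on_subset_cderivative V r X Y reg_on_subset_drop_reg)

lemma reg_on_subset_differentiable:
  assumes "reg_on_subset r f V" "openin (top_of_set M) V" "p \<in> V" "regularity_ge r 1"
  shows "f differentiable (at p within M)"
  using reg_on_subset_has_derivative[OF assms] differentiableI by blast

section \<open>The associated frame\<close>

lemma exhaust_5:
  fixes x :: 5
  shows "x = 1 \<or> x = 2 \<or> x = 3 \<or> x = 4 \<or> x = 5"
proof (induct x)
  case (of_int z)
  then have "z = 0 \<or> z = 1 \<or> z = 2 \<or> z = 3 \<or> z = 4" by fastforce
  then show ?case by auto
qed

lemma forall_5: "(\<forall>i::5. P i) \<longleftrightarrow> P 1 \<and> P 2 \<and> P 3 \<and> P 4 \<and> P 5"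
  by (metis exhaust_5)

lemma UNIV_5: "UNIV = {1, 2, 3, 4, 5::5}"
  using exhaust_5 by auto

lemma sum_5: "sum f (UNIV::5 set) = f 1 + f 2 + f 3 + f 4 + f 5"
  unfolding UNIV_5 by (simp add: ac_simps)

lemma vector_5 [simp]:
  "(vector [x, y, z, w, v] :: ('a::zero)^5) $ 1 = x"
  "(vector [x, y, z, w, v] :: ('a::zero)^5) $ 2 = y"
  "(vector [x, y, z, w, v] :: ('a::zero)^5) $ 3 = z"
  "(vector [x, y, z, w, v] :: ('a::zero)^5) $ 4 = w"
  "(vector [x, y, z, w, v] :: ('a::zero)^5) $ 5 = v"
  unfolding vector_def by simp_all

section \<open>The complex line of (1,0) vectors at a point\<close>

lemma J_J [simp]: "J (J v) = - v"
  by (simp add: J_def vec_eq_iff)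

lemma linear_J: "linear J"
  by (auto intro!: linearI simp: J_def vec_eq_iff algebra_simps)

lemma inj_J: "inj J"
  by (rule inj_on_inverseI[of _ "\<lambda>v. - J v"]) (simp add: J_def vec_eq_iff)

text \<open>A (1,0) vector is determined by its real part u: it is u - \<i> J u, with the
  \<open>\<i>\<close> of the complexification.\<close>

lemma T10_iff: "X \<in> T10 M p \<longleftrightarrow> X \<in> ctangent M p \<and> snd X = - J (fst X)"
proof -
  have "(J (fst X), J (snd X)) = cscale \<i> X \<longleftrightarrow> snd X = - J (fst X)"
    by (auto simp: cscale_def linear_neg[OF linear_J])
  then show ?thesis by (auto simp: T10_def)
qed

text \<open>The real part u of \<open>X\<close> lies in \<open>H\<close>, and so does J u. They are
  linearly independent over the reals, since J u = c u would give (c^2 + 1) u = 0. So they form a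
  basis of the plane \<open>H\<close>, and the coordinates of the real part of \<open>Y\<close> in
  this basis are the real and imaginary parts of the scalar.\<close>

lemma T10_line:
  fixes M :: "(complex ^ 4) set"
  assumes sub: "subspace (tangent_space M p)" and dim5: "dim (tangent_space M p) = 5"
    and gen: "{u + J v | u v. u \<in> tangent_space M p \<and> v \<in> tangent_space M p} = UNIV"
    and X: "X \<in> T10 M p" "X \<noteq> 0" and Y: "Y \<in> T10 M p"
  obtains z where "Y = cscale z X"
proof -
  define T where "T = tangent_space M p"
  define H where "H = T \<inter> J ` T"
  have "dim (J ` T) = dim T"
    by (rule dim_image_eq[OF linear_J inj_on_subset[OF inj_J subset_UNIV]])
  moreover have "{x + y |x y. x \<in> T \<and> y \<in> J ` T} = UNIV"
    using gen unfolding T_def[symmetric] by blast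
  ultimately have "DIM(complex^4) + dim H = 10"
    using dim_sums_Int[OF _ linear_subspace_image[OF linear_J], of T T] sub dim5
    by (simp add: T_def H_def del: DIM_cart)
  then have dimH: "dim H = 2" by simp
  have in_H: "fst Z \<in> H" "J (fst Z) \<in> H" if "Z \<in> T10 M p" for Z
  proof -
    have Z: "fst Z \<in> T" "snd Z \<in> T" "snd Z = - J (fst Z)"
      using that by (auto simp: T10_iff ctangent_def T_def)
    have "J (fst Z) = - snd Z" by (subst Z(3)) simp
    then have JT: "J (fst Z) \<in> T" using Z(2) sub by (simp add: T_def subspace_neg)
    have eq: "fst Z = J (snd Z)" by (subst Z(3)) (simp add: linear_neg[OF linear_J])
    show "fst Z \<in> H"
      unfolding H_def by (rule IntI[OF Z(1)]) (subst eq, rule imageI[OF Z(2)])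
    show "J (fst Z) \<in> H"
      unfolding H_def by (rule IntI[OF JT]) (rule imageI[OF Z(1)])
  qed
  define u where "u = fst X"
  have "u \<noteq> 0"
  proof
    assume "u = 0"
    moreover from this have "snd X = 0" using X(1) by (simp add: T10_iff u_def linear_0[OF linear_J])
    ultimately have "X = 0" by (simp add: u_def prod_eq_iff)
    with X(2) show False by simp
  qed
  have nspan: "J u \<notin> span {u}"
  proof
    assume "J u \<in> span {u}"
    then obtain c where c: "J u = c *\<^sub>R u" by (auto simp: span_singleton)
    have "- u = c *\<^sub>R c *\<^sub>R u" using J_J[of u] c by (metis linear_scale[OF linear_J])
    then have "(c * c + 1) *\<^sub>R u = 0" by (simp add: scaleR_add_left eq_neg_iff_add_eq_0[symmetric])
    then show False using \<open>u \<noteq> 0\<close> by (simp add: add_nonneg_eq_0_iff)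
  qed
  moreover have "independent {u}" using \<open>u \<noteq> 0\<close> by simp
  ultimately have "independent {J u, u}" by (rule independent_insertI)
  moreover have "J u \<noteq> u" using nspan span_base by force
  ultimately have "H \<subseteq> span {J u, u}"
    using in_H[OF X(1)] dimH by (intro card_ge_dim_independent) (auto simp: u_def)
  then have "fst Y \<in> span {J u, u}" using in_H[OF Y] by blast
  then obtain a where "fst Y - a *\<^sub>R J u \<in> span {u}"
    using span_breakdown_eq by metis
  then obtain b where "fst Y - a *\<^sub>R J u = b *\<^sub>R u" by (auto simp: span_singleton)
  then have w: "fst Y = b *\<^sub>R u + a *\<^sub>R J u" by (simp add: algebra_simps)
  have "snd Y = - (b *\<^sub>R J u) + a *\<^sub>R u"
    using Y by (simp add: T10_iff w linear_add[OF linear_J] linear_scale[OF linear_J])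
  then have "Y = cscale (Complex b a) X"
    using X(1) w by (simp add: T10_iff cscale_def prod_eq_iff u_def)
  then show ?thesis by (rule that)
qed

section \<open>Complex bases of the complexified tangent space\<close>

context
  fixes M :: "'a::euclidean_space set" and p :: 'a
  assumes sub: "subspace (tangent_space M p)"
begin

lemma cplx_subspace_ctangent: "cplx.subspace (ctangent M p)"
  using cscale_in_ctangent[OF sub] add_in_ctangent[OF sub] subspace_0[OF sub]
  by (auto intro!: cplx.subspaceI simp: ctangent_def zero_prod_def)

text \<open>A real basis of the tangent space, embedded with zero imaginary part, generates the
  complexification over the complex numbers.\<close>

lemma ctangent_subset_cplx_span:
  obtains C where "finite C" "card C \<le> dim (tangent_space M p)" "ctangent M p \<subseteq> cplx.span C"
proof -
  obtain B where B: "B \<subseteq> tangent_space M p" "independent B" "tangent_space M p \<subseteq> span B"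
      "card B = dim (tangent_space M p)"
    using basis_exists by blast
  define C where "C = (\<lambda>u. (u, 0::'a)) ` B"
  have real_smult: "(c *\<^sub>R u, 0) = cscale (of_real c) (u, 0)" for c and u :: 'a
    by (simp add: cscale_def)
  have "subspace {u. (u, 0) \<in> cplx.span C}"
  proof (rule subspaceI)
    show "u + v \<in> {u. (u, 0) \<in> cplx.span C}"
      if "u \<in> {u. (u, 0) \<in> cplx.span C}" "v \<in> {u. (u, 0) \<in> cplx.span C}" for u v
      using that cplx.span_add[of "(u, 0)" C "(v, 0)"] by simp
    show "c *\<^sub>R u \<in> {u. (u, 0) \<in> cplx.span C}" if "u \<in> {u. (u, 0) \<in> cplx.span C}" for c u
      using that unfolding mem_Collect_eq real_smult by (rule cplx.span_scale)
    show "0 \<in> {u. (u, 0) \<in> cplx.span C}"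
      using cplx.span_zero[of C] by (simp add: zero_prod_def)
  qed
  moreover have "B \<subseteq> {u. (u, 0) \<in> cplx.span C}" by (auto simp: C_def intro: cplx.span_base)
  ultimately have in_span: "(u, 0) \<in> cplx.span C" if "u \<in> tangent_space M p" for u
    using span_minimal[of B "{u. (u, 0) \<in> cplx.span C}"] B(3) that by blast
  have "ctangent M p \<subseteq> cplx.span C"
  proof
    fix X assume "X \<in> ctangent M p"
    then have "(fst X, 0) + cscale \<i> (snd X, 0) \<in> cplx.span C"
      by (intro cplx.span_add cplx.span_scale in_span) (auto simp: ctangent_def)
    then show "X \<in> cplx.span C" by (simp add: cscale_def)
  qed
  moreover have "finite B" using B(2) independent_imp_finite by blast
  ultimately show ?thesis
    using that[of C] B(4) card_image_le[of B "\<lambda>u. (u, 0)"] by (auto simp: C_def)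
qed

text \<open>Turns a rank condition into a basis. Rank n for n vectors leaves no room for repetitions
  or relations, and a tangent vector outside their span would yield n + 1 independent vectors in the
  span of at most n.\<close>

lemma cplx_basis_ctangent:
  fixes F :: "'a complexified ^ 'n"
  assumes dim: "dim (tangent_space M p) = CARD('n)" "cplx.dim (range (\<lambda>i. F $ i)) = CARD('n)"
    and F: "\<And>i. F $ i \<in> ctangent M p"
  shows "inj (\<lambda>i. F $ i)" "cplx.independent (range (\<lambda>i. F $ i))"
    "cplx.span (range (\<lambda>i. F $ i)) = ctangent M p"
proof -
  let ?R = "range (\<lambda>i. F $ i)"
  have "CARD('n) \<le> card ?R" using cplx.dim_le_card'[of ?R] dim(2) by simp
  then have card: "card ?R = CARD('n)" using card_image_le[of UNIV "\<lambda>i. F $ i"] by simp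
  then show "inj (\<lambda>i. F $ i)" by (intro eq_card_imp_inj_on) auto
  show ind: "cplx.independent ?R"
  proof
    assume "cplx.dependent ?R"
    then obtain X where X: "X \<in> ?R" "X \<in> cplx.span (?R - {X})"
      unfolding cplx.dependent_def by blast
    have "Y \<in> cplx.span (?R - {X})" if "Y \<in> ?R" for Y
    proof (cases "Y = X")
      case False
      then show ?thesis using that by (intro cplx.span_base) blast
    qed (use X(2) in simp)
    then have "?R \<subseteq> cplx.span (?R - {X})" by blast
    then have "cplx.dim ?R \<le> card (?R - {X})" by (rule cplx.dim_le_card) simp
    also have "\<dots> < card ?R" using X(1) by (intro card_Diff1_less) auto
    finally show False using card dim(2) by simp
  qed
  show "cplx.span ?R = ctangent M p"
  proof
    show "cplx.span ?R \<subseteq> ctangent M p"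
      using F by (intro cplx.span_minimal cplx_subspace_ctangent) auto
    obtain C where C: "finite C" "card C \<le> dim (tangent_space M p)" "ctangent M p \<subseteq> cplx.span C"
      using ctangent_subset_cplx_span by blast
    show "ctangent M p \<subseteq> cplx.span ?R"
    proof (rule ccontr)
      assume "\<not> ctangent M p \<subseteq> cplx.span ?R"
      then obtain X where X: "X \<in> ctangent M p" "X \<notin> cplx.span ?R" by blast
      then have "cplx.independent (insert X ?R)" using ind by (intro cplx.independent_insertI)
      moreover have "insert X ?R \<subseteq> cplx.span C" using X(1) F C(3) by blast
      ultimately have "card (insert X ?R) \<le> card C" using cplx.independent_span_bound C(1) by blast
      moreover have "X \<notin> ?R" using X(2) cplx.span_base by blast
      ultimately show False using C(2) card dim(1) by simp
    qed
  qed
qed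

end

section \<open>The fields T and S of one generator\<close>

lemma local_generatorD:
  assumes "local_generator r M V L"
  shows "openin (top_of_set M) V" "reg_on_subset (drop_reg r 1) L V"
    "\<And>p. p \<in> V \<Longrightarrow> L p \<in> T10 M p" "\<And>p. p \<in> V \<Longrightarrow> L p \<in> ctangent M p" "\<And>p. p \<in> V \<Longrightarrow> L p \<noteq> 0"
  using assms by (auto simp: local_generator_def local_section_def T10_def)

context
  fixes M :: "(complex ^ 'n) set" and r V L and d :: nat
  assumes M: "embedded_submanifold r d M" and r: "regularity_ge r 3" and L: "local_generator r M V L"
begin

text \<open>The derivative count: [L, L'] needs one derivative of L, of class
  \<open>drop_reg r 1\<close>, and [L, T] one of T, of class \<open>drop_reg r 2\<close>. The latter
  requires C^3. Tangency of brackets requires C^2 charts.\<close>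

private lemma r_ge: "regularity_ge r 2" "regularity_ge r 1" "regularity_ge (drop_reg r 1) 1"
    "regularity_ge (drop_reg r 2) 1"
  using r by (auto intro: regularity_ge_le intro!: regularity_ge_drop)

private lemmas V = local_generatorD(1)[OF L]

lemma generator_subspace: "p \<in> V \<Longrightarrow> subspace (tangent_space M p)"
  using subspace_tangent_space[OF M _ r_ge(2)] openin_imp_subset[OF V] by blast

lemma reg_on_subset_generator_cconj: "reg_on_subset (drop_reg r 1) (\<lambda>q. cconj (L q)) V"
  by (rule reg_on_subset_bounded_linear[OF bounded_linear_cconj local_generatorD(2)[OF L]])

lemma generator_cconj_in_ctangent: "p \<in> V \<Longrightarrow> cconj (L p) \<in> ctangent M p"
  using cconj_in_ctangent[OF generator_subspace local_generatorD(4)[OF L]] .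

lemma generator_differentiable:
  assumes "p \<in> V"
  shows "L differentiable (at p within M)" "(\<lambda>q. cconj (L q)) differentiable (at p within M)"
  using reg_on_subset_differentiable[OF _ V assms r_ge(3)] local_generatorD(2)[OF L]
    reg_on_subset_generator_cconj by blast+

lemma reg_on_subset_bracket: "reg_on_subset (drop_reg r 2) (lie_bracket M L (\<lambda>q. cconj (L q))) V"
  using reg_on_subset_lie_bracket[OF V r_ge(3) local_generatorD(2,4)[OF L]
      reg_on_subset_generator_cconj generator_cconj_in_ctangent]
  by (simp add: numeral_2_eq_2)

lemma bracket_in_ctangent: "p \<in> V \<Longrightarrow> lie_bracket M L (\<lambda>q. cconj (L q)) p \<in> ctangent M p"
  by (rule lie_bracket_in_ctangent[OF M r_ge(1) V _ local_generatorD(4)[OF L] generator_differentiable(1)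
        generator_cconj_in_ctangent generator_differentiable(2)])

lemma bracket_differentiable: "p \<in> V \<Longrightarrow> lie_bracket M L (\<lambda>q. cconj (L q)) differentiable (at p within M)"
  using reg_on_subset_differentiable[OF reg_on_subset_bracket V _ r_ge(4)] .

lemma reg_on_subset_field_T: "reg_on_subset (drop_reg r 2) (field_T M L) V"
  unfolding field_T_def[abs_def]
  by (rule reg_on_subset_bounded_linear[OF bounded_linear_cscale reg_on_subset_bracket])

lemma field_T_in_ctangent: "p \<in> V \<Longrightarrow> field_T M L p \<in> ctangent M p"
  unfolding field_T_def by (rule cscale_in_ctangent[OF generator_subspace bracket_in_ctangent])

lemma field_T_differentiable: "p \<in> V \<Longrightarrow> field_T M L differentiable (at p within M)"
  using reg_on_subset_differentiable[OF reg_on_subset_field_T V _ r_ge(4)] .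

lemma reg_on_subset_field_S: "reg_on_subset (drop_reg r 3) (field_S M L) V"
proof -
  have "reg_on_subset (drop_reg r 2) L V"
    using reg_on_subset_drop_reg[OF local_generatorD(2)[OF L], of 1] by (simp add: numeral_2_eq_2)
  from reg_on_subset_lie_bracket[OF V r_ge(4) this local_generatorD(4)[OF L]
      reg_on_subset_field_T field_T_in_ctangent]
  show ?thesis by (simp add: field_S_def[abs_def])
qed

lemma field_S_in_ctangent: "p \<in> V \<Longrightarrow> field_S M L p \<in> ctangent M p"
  unfolding field_S_def
  by (rule lie_bracket_in_ctangent[OF M r_ge(1) V _ local_generatorD(4)[OF L] generator_differentiable(1)
        field_T_in_ctangent field_T_differentiable])

text \<open>Conjugation exchanges the two arguments of the bracket, and the resulting sign cancels
  that of the conjugate of \<open>\<i>\<close>.\<close>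

lemma cconj_field_T:
  assumes "p \<in> V"
  shows "cconj (field_T M L p) = field_T M L p"
proof -
  have pM: "p \<in> M" using assms openin_imp_subset[OF V] by blast
  have "cconj (lie_bracket M L (\<lambda>q. cconj (L q)) p) = lie_bracket M (\<lambda>q. cconj (L q)) L p"
    using lie_bracket_cconj[OF pM generator_differentiable[OF assms] local_generatorD(4)[OF L assms]
        generator_cconj_in_ctangent[OF assms] generator_subspace[OF assms]] by simp
  also have "\<dots> = - lie_bracket M L (\<lambda>q. cconj (L q)) p" by (rule lie_bracket_anticomm)
  finally show ?thesis unfolding field_T_def cconj_cscale by (simp add: cscale_minus_left)
qed

text \<open>Conjugating [L, T] conjugates both arguments, and T is real on \<open>V\<close>.\<close>

lemma cconj_field_S:
  assumes "p \<in> V"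
  shows "cconj (field_S M L p) = lie_bracket M (\<lambda>q. cconj (L q)) (field_T M L) p"
proof -
  have pM: "p \<in> M" using assms openin_imp_subset[OF V] by blast
  have "cconj (field_S M L p) = lie_bracket M (\<lambda>q. cconj (L q)) (\<lambda>q. cconj (field_T M L q)) p"
    unfolding field_S_def
    by (rule lie_bracket_cconj[symmetric]) (use assms pM in \<open>auto intro: generator_differentiable
        field_T_differentiable field_T_in_ctangent local_generatorD(4)[OF L] generator_subspace\<close>)
  also have "\<dots> = lie_bracket M (\<lambda>q. cconj (L q)) (field_T M L) p"
    by (rule lie_bracket_cong[OF V assms]) (auto simp: cconj_field_T)
  finally show ?thesis .
qed

end

text \<open>The rank condition of the class is stated for the plain brackets, while the frame is
  built from T. As \<open>\<i>\<close> is constant it passes through the outer brackets, so the two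
  quintuples differ by nonzero scalars and have the same span.\<close>

lemma associated_frame_local_frame:
  fixes M :: "(complex ^ 4) set"
  assumes M: "embedded_submanifold r 5 M" and r: "regularity_ge r 3" and L: "local_generator r M V L"
    and III: "class_III1 r M"
  shows "local_frame (drop_reg r 3) (ctangent M) V (associated_frame M L)"
proof -
  note LD = local_generatorD[OF L] and ctx = M r L
  \<comment> \<open>The five fields have different classes; all are lowered to that of S, the
    smallest.\<close>
  have drop: "reg_on_subset (drop_reg r 3) f V" if "reg_on_subset (drop_reg r k) f V" "k \<le> 3"
    for f :: "complex ^ 4 \<Rightarrow> (complex ^ 4) complexified" and k
    using reg_on_subset_drop_reg[OF that(1), of "3 - k"] that(2) by simp
  have S_reg: "reg_on_subset (drop_reg r 3) (field_S M L) V" by (rule reg_on_subset_field_S[OF ctx])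
  have sections: "local_section (drop_reg r 3) (ctangent M) V (\<lambda>p. associated_frame M L p $ i)" for i
  proof -
    have "\<forall>i. local_section (drop_reg r 3) (ctangent M) V (\<lambda>p. associated_frame M L p $ i)"
      unfolding forall_5 associated_frame_def vector_5 local_section_def
      using drop[OF LD(2)] drop[OF reg_on_subset_generator_cconj[OF ctx]]
        drop[OF reg_on_subset_field_T[OF ctx]] S_reg
        reg_on_subset_bounded_linear[OF bounded_linear_cconj S_reg]
        LD(4) generator_cconj_in_ctangent[OF ctx] field_T_in_ctangent[OF ctx] field_S_in_ctangent[OF ctx]
        cconj_in_ctangent[OF generator_subspace[OF ctx] field_S_in_ctangent[OF ctx]]
      by simp
    then show ?thesis by blast
  qed
  show ?thesis
    unfolding local_frame_def
  proof (intro conjI allI ballI sections)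
    fix p assume p: "p \<in> V"
    have pM: "p \<in> M" using p openin_imp_subset[OF LD(1)] by blast
    define L' where "L' = (\<lambda>q. cconj (L q))"
    define B where "B = lie_bracket M L L'"
    let ?R = "range (\<lambda>i. associated_frame M L p $ i)"
    let ?S = "{L p, L' p, B p, lie_bracket M L B p, lie_bracket M L' B p}"
    note sub = generator_subspace[OF ctx p]
    have T: "field_T M L = (\<lambda>q. cscale \<i> (B q))"
      by (simp add: field_T_def[abs_def] B_def L'_def)
    have B: "B differentiable (at p within M)" "B p \<in> ctangent M p"
      using bracket_differentiable[OF ctx p] bracket_in_ctangent[OF ctx p] by (simp_all add: B_def L'_def)
    note const = lie_bracket_cscale_const_right[OF pM _ B(1) _ B(2) sub, of _ \<i>]
    have S: "field_S M L p = cscale \<i> (lie_bracket M L B p)"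
      unfolding field_S_def T by (rule const[OF generator_differentiable(1)[OF ctx p] LD(4)[OF p]])
    have S': "cconj (field_S M L p) = cscale \<i> (lie_bracket M L' B p)"
      unfolding cconj_field_S[OF ctx p] T L'_def
      by (rule const[OF generator_differentiable(2)[OF ctx p] generator_cconj_in_ctangent[OF ctx p]])
    have R: "?R = {L p, L' p, cscale \<i> (B p), cscale \<i> (lie_bracket M L B p), cscale \<i> (lie_bracket M L' B p)}"
      unfolding UNIV_5 associated_frame_def image_insert image_empty vector_5
      unfolding S' unfolding S T L'_def ..
    have "X \<in> cplx.span ?R" if "cscale \<i> X \<in> ?R" for X
      using cplx.span_scale[OF cplx.span_base[OF that], of "- \<i>"] by simp
    then have "?S \<subseteq> cplx.span ?R" by (simp add: R cplx.span_base)
    moreover have "?R \<subseteq> cplx.span ?S" by (simp add: R cplx.span_base cplx.span_scale)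
    ultimately have "cplx.dim ?R = cplx.dim ?S"
      by (intro cplx.span_eq_dim) (simp add: cplx.span_eq)
    also have "\<dots> = 5"
      using III L p unfolding class_III1_def Let_def B_def L'_def by blast
    finally have dimR: "cplx.dim ?R = CARD(5)" by simp
    have dimT: "dim (tangent_space M p) = CARD(5)"
      using dim_tangent_space[OF M pM] regularity_ge_le[OF r] by simp
    have "associated_frame M L p $ i \<in> ctangent M p" for i
      using sections p by (auto simp: local_section_def)
    note basis = cplx_basis_ctangent[OF sub dimT dimR this]
    show "inj (\<lambda>i. associated_frame M L p $ i)" "cplx.independent ?R" "cplx.span ?R = ctangent M p"
      by (fact basis)+
  qed
qed

section \<open>The initial structure group\<close>

lemma group_GL: "group (GL :: (complex ^ 'n ^ 'n) monoid)"
proof (rule groupI)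
  fix A :: "complex ^ 'n ^ 'n" assume "A \<in> carrier GL"
  then obtain B where "A ** B = mat 1" "B ** A = mat 1" by (auto simp: GL_def invertible_def)
  then show "\<exists>B\<in>carrier GL. B \<otimes>\<^bsub>GL\<^esub> A = \<one>\<^bsub>GL\<^esub>"
    by (intro bexI[of _ B]) (auto simp: GL_def invertible_def)
next
  show "\<one>\<^bsub>GL\<^esub> \<in> carrier (GL :: (complex ^ 'n ^ 'n) monoid)"
    by (simp add: GL_def invertible_def exI[of _ "mat 1"])
qed (auto simp: GL_def invertible_mult matrix_mul_assoc)

definition G_mat :: "complex \<Rightarrow> complex \<Rightarrow> complex \<Rightarrow> complex \<Rightarrow> complex \<Rightarrow> complex ^ 5 ^ 5" where
  "G_mat a b c d e =
     vector [vector [a,     0,     0,         0,             0],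
             vector [0,     cnj a, 0,         0,             0],
             vector [b,     cnj b, a * cnj a, 0,             0],
             vector [e,     d,     c,         a * a * cnj a, 0],
             vector [cnj d, cnj e, cnj c,     0,             a * cnj a * cnj a]]"

lemma G_III1_initial_eq: "G_III1_initial = {G_mat a b c d e | a b c d e. a \<noteq> 0}"
  by (simp add: G_III1_initial_def G_mat_def)

text \<open>The parameters of the product can be read off from rows 1, 3 and 4; rows 2 and 5 repeat
  the computation in conjugate form.\<close>

lemma G_mat_mult:
  "G_mat a b c d e ** G_mat a' b' c' d' e' =
     G_mat (a * a') (b * a' + a * cnj a * b') (c * (a' * cnj a') + a * a * cnj a * c')
       (d * cnj a' + c * cnj b' + a * a * cnj a * d') (e * a' + c * b' + a * a * cnj a * e')"
  unfolding vec_eq_iff forall_5 G_mat_def matrix_matrix_mult_def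
  by (simp add: sum_5 algebra_simps)

lemma G_mat_one: "G_mat 1 0 0 0 0 = mat 1"
  unfolding vec_eq_iff forall_5 G_mat_def mat_def by simp

text \<open>The matrices are lower triangular, so the equations are solved in turn:
  \<open>c'\<close> makes the entry (4, 3) vanish, and with it \<open>d'\<close> and
  \<open>e'\<close> clear the entries (4, 2) and (4, 1). A left inverse of a square matrix is
  enough.\<close>

lemma G_mat_left_inverse:
  assumes "a \<noteq> 0"
  obtains b' c' d' e' where "G_mat (inverse a) b' c' d' e' ** G_mat a b c d e = mat 1"
proof -
  define \<alpha> where "\<alpha> = inverse a"
  define c' where "c' = - (\<alpha> * \<alpha> * cnj \<alpha> * c * (\<alpha> * cnj \<alpha>))"
  have \<alpha>: "\<alpha> * a = 1" "cnj \<alpha> * cnj a = 1"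
    using assms by (simp_all add: \<alpha>_def flip: complex_cnj_mult)
  have "G_mat \<alpha> (- (\<alpha> * cnj \<alpha> * b * \<alpha>)) c' (- ((c' * cnj b + \<alpha> * \<alpha> * cnj \<alpha> * d) * cnj \<alpha>))
      (- ((c' * b + \<alpha> * \<alpha> * cnj \<alpha> * e) * \<alpha>)) ** G_mat a b c d e = G_mat 1 0 0 0 0"
  proof -
    have 1: "- (\<alpha> * cnj \<alpha> * b * \<alpha>) * a + \<alpha> * cnj \<alpha> * b = 0" using \<alpha> by algebra
    have 2: "c' * (a * cnj a) + \<alpha> * \<alpha> * cnj \<alpha> * c = 0" unfolding c'_def using \<alpha> by algebra
    have 3: "- ((x + y) * cnj \<alpha>) * cnj a + x + y = 0" for x y using \<alpha> by algebra
    have 4: "- ((x + y) * \<alpha>) * a + x + y = 0" for x y using \<alpha> by algebra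
    show ?thesis unfolding G_mat_mult 1 2 3 4 \<alpha>(1) ..
  qed
  then show ?thesis using that unfolding G_mat_one \<alpha>_def by blast
qed

lemma subgroup_G_III1_initial: "subgroup G_III1_initial GL"
proof -
  interpret group "GL :: (complex ^ 5 ^ 5) monoid" by (rule group_GL)
  have GL: "A \<in> carrier GL" if A: "A \<in> G_III1_initial" for A
  proof -
    obtain a b c d e where a: "A = G_mat a b c d e" "a \<noteq> 0" using A unfolding G_III1_initial_eq by blast
    then obtain b' c' d' e' where "G_mat (inverse a) b' c' d' e' ** A = mat 1"
      using G_mat_left_inverse[OF a(2)] by metis
    then have "invertible A" unfolding invertible_left_inverse by blast
    then show ?thesis by (simp add: GL_def)
  qed
  show ?thesis
  proof (rule subgroupI)
    show "G_III1_initial \<subseteq> carrier GL" using GL by blast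
    show "G_III1_initial \<noteq> {}" unfolding G_III1_initial_eq using one_neq_zero by blast
    show "A \<otimes>\<^bsub>GL\<^esub> B \<in> G_III1_initial" if AB: "A \<in> G_III1_initial" "B \<in> G_III1_initial" for A B
    proof -
      obtain a b c d e where A: "A = G_mat a b c d e" "a \<noteq> 0" using AB(1) unfolding G_III1_initial_eq by blast
      obtain a' b' c' d' e' where B: "B = G_mat a' b' c' d' e'" "a' \<noteq> 0" using AB(2) unfolding G_III1_initial_eq by blast
      have "a * a' \<noteq> 0" using A B by simp
      then have "G_mat a b c d e ** G_mat a' b' c' d' e' \<in> G_III1_initial"
        unfolding G_III1_initial_eq G_mat_mult by blast
      then show ?thesis unfolding A(1) B(1) by (simp add: GL_def)
    qed
    show "inv\<^bsub>GL\<^esub> A \<in> G_III1_initial" if A: "A \<in> G_III1_initial" for A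
    proof -
      obtain a b c d e where a: "A = G_mat a b c d e" "a \<noteq> 0" using A unfolding G_III1_initial_eq by blast
      obtain b' c' d' e' where N: "G_mat (inverse a) b' c' d' e' ** A = mat 1"
        using G_mat_left_inverse[OF a(2)] a(1) by metis
      have "inverse a \<noteq> 0" using a(2) by simp
      then have in_G: "G_mat (inverse a) b' c' d' e' \<in> G_III1_initial" unfolding G_III1_initial_eq by blast
      then have "inv\<^bsub>GL\<^esub> A = G_mat (inverse a) b' c' d' e'"
        using N GL A by (intro inv_equality) (auto simp: GL_def)
      then show ?thesis using in_G by simp
    qed
  qed
qed

section \<open>The group as a submanifold and as a closed set\<close>

text \<open>\<open>G_III1_initial\<close> is the graph of the polynomial map \<open>G_quadratic\<close>, which depends on the
  entry \<open>a\<close> only, over the part \<open>a \<noteq> 0\<close> of the linear space \<open>range G_linear\<close>.\<close>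

definition G_linear :: "complex ^ 5 \<Rightarrow> complex ^ 5 ^ 5" where
  "G_linear x =
     vector [vector [x $ 1,       0,           0,           0, 0],
             vector [0,           cnj (x $ 1), 0,           0, 0],
             vector [x $ 2,       cnj (x $ 2), 0,           0, 0],
             vector [x $ 5,       x $ 4,       x $ 3,       0, 0],
             vector [cnj (x $ 4), cnj (x $ 5), cnj (x $ 3), 0, 0]]"

text \<open>Kept real-linear in z and w, so that smoothness only concerns the two monomials a cnj a
  and a a cnj a; the last diagonal entry is the conjugate of the second monomial.\<close>

definition G_diag :: "complex \<Rightarrow> complex \<Rightarrow> complex ^ 5 ^ 5" where
  "G_diag z w =
     vector [0, 0, vector [0, 0, z, 0, 0], vector [0, 0, 0, w, 0], vector [0, 0, 0, 0, cnj w]]"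

definition G_polynomial :: "complex ^ 5 ^ 5 \<Rightarrow> complex ^ 5 ^ 5" where
  "G_polynomial A = G_diag (A $ 1 $ 1 * cnj (A $ 1 $ 1)) (A $ 1 $ 1 * (A $ 1 $ 1 * cnj (A $ 1 $ 1)))"

lemma linear_G_linear: "linear G_linear"
  unfolding linear_iff vec_eq_iff forall_5 G_linear_def by (simp add: vec_eq_iff forall_5)

lemma inj_G_linear: "inj G_linear"
proof (rule injI)
  fix x y assume "G_linear x = G_linear y"
  then have "G_linear x $ i $ j = G_linear y $ i $ j" for i j by simp
  from this[of 1 1] this[of 3 1] this[of 4 1] this[of 4 2] this[of 4 3]
  show "x = y" by (simp add: vec_eq_iff forall_5 G_linear_def)
qed

lemma G_III1_initial_graph: "A \<in> G_III1_initial \<longleftrightarrow> A $ 1 $ 1 \<noteq> 0 \<and> A - G_polynomial A \<in> range G_linear"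
proof
  assume "A \<in> G_III1_initial"
  then obtain a b c d e where A: "A = G_mat a b c d e" "a \<noteq> 0" unfolding G_III1_initial_eq by blast
  have "A - G_polynomial A = G_linear (vector [a, b, c, d, e])"
    unfolding A(1) vec_eq_iff forall_5 G_mat_def G_polynomial_def G_diag_def G_linear_def by simp
  then show "A $ 1 $ 1 \<noteq> 0 \<and> A - G_polynomial A \<in> range G_linear"
    using A by (simp add: G_mat_def)
next
  assume A: "A $ 1 $ 1 \<noteq> 0 \<and> A - G_polynomial A \<in> range G_linear"
  then obtain x where x: "A - G_polynomial A = G_linear x" by blast
  then have eq: "A $ i $ j = G_linear x $ i $ j + G_polynomial A $ i $ j" for i j
    by (metis (no_types) diff_add_cancel vector_add_component)
  \<comment> \<open>The nonlinear part has entry 0 at (1, 1), so the parameter a of the linear part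
    is the one that enters the nonlinear diagonal.\<close>
  have 1: "A $ 1 $ 1 = x $ 1" using eq[of 1 1] by (simp add: G_linear_def G_polynomial_def G_diag_def)
  have poly: "G_polynomial A = G_diag (x $ 1 * cnj (x $ 1)) (x $ 1 * (x $ 1 * cnj (x $ 1)))"
    by (simp only: G_polynomial_def 1)
  have "A = G_mat (x $ 1) (x $ 2) (x $ 3) (x $ 4) (x $ 5)"
    unfolding vec_eq_iff forall_5 eq[unfolded poly]
    by (simp add: G_mat_def G_linear_def G_diag_def)
  moreover have "x $ 1 \<noteq> 0" using A 1 by simp
  ultimately show "A \<in> G_III1_initial" unfolding G_III1_initial_eq by blast
qed

text \<open>The coefficient \<open>c\<close> takes the values -1 and 1, for the straightening shear
  and for its inverse.\<close>

lemma reg_on_G_polynomial: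
  assumes "open U"
  shows "reg_on Cinf (\<lambda>A. A + c *\<^sub>R G_polynomial A) U"
proof -
  have ident: "reg_on Cinf (\<lambda>A :: complex ^ 5 ^ 5. A) U"
    using Ck_on_ident[OF assms] by (simp add: reg_on_def)
  have entry: "reg_on Cinf (\<lambda>A :: complex ^ 5 ^ 5. A $ 1 $ 1) U"
    by (rule reg_on_bounded_linear[OF assms _ ident])
      (intro bounded_linear_compose[OF bounded_linear_vec_nth bounded_linear_vec_nth])
  note mult = reg_on_bounded_bilinear[OF assms bounded_bilinear_mult]
    and cnj = reg_on_bounded_linear[OF assms bounded_linear_cnj]
    and linear = reg_on_bounded_linear[OF assms linear_conv_bounded_linear[THEN iffD1]]
  have diag: "linear (\<lambda>z. G_diag z 0)" "linear (\<lambda>w. G_diag 0 w)"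
    unfolding linear_iff vec_eq_iff forall_5 G_diag_def by (simp_all add: vec_eq_iff forall_5)
  have "G_polynomial = (\<lambda>A. G_diag (A $ 1 $ 1 * cnj (A $ 1 $ 1)) 0 +
      G_diag 0 (A $ 1 $ 1 * (A $ 1 $ 1 * cnj (A $ 1 $ 1))))"
    unfolding fun_eq_iff vec_eq_iff forall_5 G_diag_def G_polynomial_def by simp
  moreover have "reg_on Cinf (\<lambda>A. G_diag (A $ 1 $ 1 * cnj (A $ 1 $ 1)) 0 +
      G_diag 0 (A $ 1 $ 1 * (A $ 1 $ 1 * cnj (A $ 1 $ 1)))) U"
    by (rule reg_on_add[OF assms linear[OF diag(1) mult[OF entry cnj[OF entry]]]
          linear[OF diag(2) mult[OF entry mult[OF entry cnj[OF entry]]]]])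
  ultimately have "reg_on Cinf G_polynomial U" by simp
  then show ?thesis
    by (rule reg_on_add[OF assms ident reg_on_bounded_linear[OF assms bounded_linear_scaleR_right]])
qed

text \<open>Subtracting \<open>G_polynomial\<close> leaves the entry (1, 1) unchanged, and
  \<open>G_polynomial\<close> depends on that entry only; so adding it back inverts the map. This
  one chart, on the set where the entry is nonzero, flattens the whole group to an injective image
  of a space of 5 complex, hence 10 real dimensions.\<close>

lemma embedded_submanifold_G_III1_initial: "embedded_submanifold Cinf 10 G_III1_initial"
  unfolding embedded_submanifold_def
proof
  fix P assume P: "P \<in> G_III1_initial"
  define U where "U = {A :: complex ^ 5 ^ 5. A $ 1 $ 1 \<noteq> 0}"
  define \<phi> where "\<phi> = (\<lambda>A. A + (-1) *\<^sub>R G_polynomial A)"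
  define \<psi> where "\<psi> = (\<lambda>A. A + 1 *\<^sub>R G_polynomial A)"
  have U: "open U" unfolding U_def
    by (intro open_Collect_neq continuous_intros)
  have entry: "\<phi> A $ 1 $ 1 = A $ 1 $ 1" "\<psi> A $ 1 $ 1 = A $ 1 $ 1" for A
    by (simp_all add: \<phi>_def \<psi>_def G_polynomial_def G_diag_def)
  have poly: "G_polynomial (\<phi> A) = G_polynomial A" "G_polynomial (\<psi> A) = G_polynomial A" for A
    by (simp_all add: G_polynomial_def entry)
  have inv: "\<psi> (\<phi> A) = A" "\<phi> (\<psi> A) = A" for A
    by (simp add: \<psi>_def poly, simp add: \<phi>_def) (simp add: \<phi>_def poly, simp add: \<psi>_def)
  have reg: "reg_on Cinf \<phi> U" "reg_on Cinf \<psi> U"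
    unfolding \<phi>_def \<psi>_def by (rule reg_on_G_polynomial[OF U])+
  then have "continuous_on U \<phi>" "continuous_on U \<psi>"
    by (auto simp: reg_on_def dest: spec[of _ 0])
  then have homeo: "homeomorphism U U \<phi> \<psi>"
    by (intro homeomorphismI) (auto simp: U_def entry inv)
  have "\<phi> ` (U \<inter> G_III1_initial) = U \<inter> range G_linear"
  proof (intro subset_antisym subsetI)
    fix B assume B: "B \<in> U \<inter> range G_linear"
    then have "\<psi> B \<in> U \<inter> G_III1_initial"
      using inv(2)[of B] poly(2)[of B] by (auto simp: G_III1_initial_graph U_def entry) (simp add: \<psi>_def)
    then show "B \<in> \<phi> ` (U \<inter> G_III1_initial)" using inv(2)[of B] by (metis imageI)
  qed (auto simp: U_def entry G_III1_initial_graph, auto simp: \<phi>_def)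
  moreover have "subspace (range G_linear)"
    using linear_subspace_image[OF linear_G_linear subspace_UNIV] .
  moreover have "dim (range G_linear) = 10"
    using dim_image_eq[OF linear_G_linear inj_on_subset[OF inj_G_linear subset_UNIV], of UNIV] by simp
  moreover have "P \<in> U" using P by (simp add: G_III1_initial_graph U_def)
  ultimately show "\<exists>U U' W \<phi> \<psi>. open U \<and> P \<in> U \<and> open U' \<and> subspace W \<and> dim W = 10 \<and>
      homeomorphism U U' \<phi> \<psi> \<and> reg_on Cinf \<phi> U \<and> reg_on Cinf \<psi> U' \<and>
      \<phi> ` (U \<inter> G_III1_initial) = U' \<inter> (W :: (complex ^ 5 ^ 5) set)"
    using U homeo reg by blast
qed

text \<open>The graph condition is closed among all matrices; a \<noteq> 0 is not, but follows from
  invertibility. If the entry (1, 1) is 0, the condition forces the entire first row to be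
  0.\<close>

lemma closedin_G_III1_initial: "closedin (top_of_set (carrier GL)) G_III1_initial"
  unfolding closedin_closed
proof (intro exI conjI)
  have "closed (range G_linear)"
    by (intro closed_subspace linear_subspace_image[OF linear_G_linear subspace_UNIV])
  moreover have "continuous_on UNIV (\<lambda>A. A - G_polynomial A)"
    using reg_on_G_polynomial[of UNIV "-1"] by (auto simp: reg_on_def dest: spec[of _ 0])
  ultimately show "closed ((\<lambda>A. A - G_polynomial A) -` range G_linear)"
    by (simp add: continuous_closed_vimage continuous_on_eq_continuous_at)
  have "A $ 1 $ 1 \<noteq> 0" if A: "A \<in> carrier GL" "A - G_polynomial A \<in> range G_linear" for A
  proof
    assume 0: "A $ 1 $ 1 = 0"
    obtain x where x: "A - G_polynomial A = G_linear x" using A(2) by blast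
    then have eq: "A $ i $ j = G_linear x $ i $ j + G_polynomial A $ i $ j" for i j
      by (metis (no_types) diff_add_cancel vector_add_component)
    have poly: "G_polynomial A = G_diag 0 0" by (simp add: G_polynomial_def 0)
    have "A $ 1 $ j = 0" for j
    proof -
      have "\<forall>j. A $ 1 $ j = 0"
        using 0 eq[of 1 1] unfolding forall_5 eq[unfolded poly]
        by (simp add: G_linear_def poly G_diag_def)
      then show ?thesis by blast
    qed
    moreover obtain B where "A ** B = mat 1" using A(1) by (auto simp: GL_def invertible_def)
    then have "(A ** B) $ 1 $ 1 = 1" by (simp add: mat_def)
    ultimately show False by (simp add: matrix_matrix_mult_def)
  qed
  then show "G_III1_initial = carrier GL \<inter> (\<lambda>A. A - G_polynomial A) -` range G_linear"
    using subgroup.subset[OF subgroup_G_III1_initial] by (auto simp: G_III1_initial_graph)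
qed

section \<open>Change of generator\<close>

text \<open>In the real inner product of pairs, \<open>X\<close> and \<open>cscale \<i> X\<close>
  are orthogonal and of equal norm. For Y = z X the two quotients are therefore Re z and Im z. Being
  an explicit formula in \<open>X\<close> and \<open>Y\<close>, the coefficient inherits their
  regularity.\<close>

definition cscale_coefficient :: "'a::real_inner complexified \<Rightarrow> 'a complexified \<Rightarrow> complex" where
  "cscale_coefficient Y X = of_real (inner Y X * inverse (inner X X)) +
     \<i> * of_real (inner Y (cscale \<i> X) * inverse (inner X X))"

lemma cscale_coefficient_cscale:
  assumes "X \<noteq> 0"
  shows "cscale_coefficient (cscale z X) X = z"
proof -
  have "inner (cscale z X) X = Re z * inner X X" "inner (cscale z X) (cscale \<i> X) = Im z * inner X X"
    by (simp_all add: cscale_def inner_prod_def inner_commute algebra_simps)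
  then show ?thesis using assms by (simp add: cscale_coefficient_def complex_eq_iff power2_eq_square)
qed

text \<open>A local extension of \<open>f\<close> can vanish off \<open>V\<close>, so its domain is
  first restricted to the open set where it does not.\<close>

lemma reg_on_subset_inverse:
  fixes f :: "'a::euclidean_space \<Rightarrow> real"
  assumes f: "reg_on_subset (Ck k) f V" and nz: "\<And>x. x \<in> V \<Longrightarrow> f x \<noteq> 0"
  shows "reg_on_subset (Ck k) (\<lambda>x. inverse (f x)) V"
  unfolding reg_on_subset_def
proof
  fix p assume p: "p \<in> V"
  obtain U g where U: "open U" "p \<in> U" "Ck_on k g U" "\<forall>x\<in>U \<inter> V. g x = f x"
    using f p unfolding reg_on_subset_def reg_on_def by auto
  have "continuous_on U g" using Ck_on_le[OF U(3), of 0] by simp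
  then have "open (U \<inter> g -` (- {0}))"
    using U(1) by (simp add: continuous_on_open_vimage Int_commute open_Compl)
  moreover have "Ck_on k (\<lambda>x. inverse (g x)) (U \<inter> g -` (- {0}))"
    using calculation by (rule Ck_on_inverse) (auto intro: Ck_on_subset[OF U(3)])
  ultimately show "\<exists>U h. open U \<and> p \<in> U \<and> reg_on (Ck k) h U \<and> (\<forall>x\<in>U \<inter> V. h x = inverse (f x))"
    using U(2,4) p nz[OF p]
    by (intro exI[of _ "U \<inter> g -` (- {0})"] exI[of _ "\<lambda>x. inverse (g x)"]) (auto simp: reg_on_def)
qed

lemma reg_on_subset_cscale_coefficient:
  fixes X Y :: "'a::euclidean_space \<Rightarrow> 'b::euclidean_space complexified"
  assumes X: "reg_on_subset (Ck k) X V" "\<And>q. q \<in> V \<Longrightarrow> X q \<noteq> 0" and Y: "reg_on_subset (Ck k) Y V"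
  shows "reg_on_subset (Ck k) (\<lambda>q. cscale_coefficient (Y q) (X q)) V"
proof -
  note inner = reg_on_subset_bounded_bilinear[OF bounded_bilinear_inner]
    and mult = reg_on_subset_bounded_bilinear[OF bounded_bilinear_mult]
    and of_real = reg_on_subset_bounded_linear[OF bounded_linear_of_real]
    and i = reg_on_subset_bounded_linear[OF bounded_linear_mult_right]
  have inv: "reg_on_subset (Ck k) (\<lambda>q. inverse (inner (X q) (X q))) V"
    using X(2) by (intro reg_on_subset_inverse inner X(1)) auto
  show ?thesis
    unfolding cscale_coefficient_def
    by (intro reg_on_subset_add i of_real mult inner inv Y X(1)
        reg_on_subset_bounded_linear[OF bounded_linear_cscale])
qed

text \<open>Rows 2 and 5 are the conjugates of rows 1 and 4. In the fifth row the conjugate of d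
  moves to the column of \<open>X\<close> and that of e to the column of its conjugate, while
  \<open>T\<close>, being real, keeps its column.\<close>

lemma frame_change_matrix:
  fixes T S T' S' X Y :: "(complex ^ 'n) complexified"
  assumes "Y = cscale a X"
    and "T' = cscale (a * cnj a) T + cscale b X + cscale (cnj b) (cconj X)"
    and "S' = cscale (a * a * cnj a) S + cscale c T + cscale d (cconj X) + cscale e X"
    and "cconj T = T"
  shows "(vector [Y, cconj Y, T', S', cconj S'] :: (complex ^ 'n) complexified ^ 5) =
    frame_action (G_mat a b c d e)
     (vector [X, cconj X, T, S, cconj S] :: (complex ^ 'n) complexified ^ 5)"
  unfolding vec_eq_iff forall_5 frame_action_def G_mat_def
  using assms(4) by (simp add: sum_5 assms(1-3) cconj_add cconj_cscale mult_ac)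

context
  fixes M :: "(complex ^ 'n) set" and r V L\<^sub>1 L\<^sub>2 and a and n :: nat
  assumes M: "embedded_submanifold r n M" and r: "regularity_ge r 3"
    and L1: "local_generator r M V L\<^sub>1" and L2: "local_generator r M V L\<^sub>2"
    and a: "reg_on_subset (Ck 2) a V" and L2_eq: "\<And>q. q \<in> V \<Longrightarrow> L\<^sub>2 q = cscale (a q) (L\<^sub>1 q)"
begin

private lemmas ctx = M r L1
private lemmas openin_V = local_generatorD(1)[OF L1]

text \<open>A function of the point and not merely a number at \<open>p\<close>, because it is
  differentiated in the computation of S.\<close>

definition coefficient_b :: "complex ^ 'n \<Rightarrow> complex" where
  "coefficient_b q = - \<i> * cnj (a q) * scalar_derivative M a q (cconj (L\<^sub>1 q))"

private lemma in_M: "q \<in> V \<Longrightarrow> q \<in> M"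
  using openin_imp_subset[OF openin_V] by blast

private lemma a_diff: "q \<in> V \<Longrightarrow> a differentiable (at q within M)"
  using reg_on_subset_differentiable[OF a openin_V] by (simp add: regularity_ge_def)

private lemma cnj_diff:
  "f differentiable (at q within M) \<Longrightarrow> (\<lambda>x. cnj (f x)) differentiable (at q within M)"
  unfolding differentiable_def using bounded_linear.has_derivative[OF bounded_linear_cnj] by blast

private lemma mult_diff:
  fixes f g :: "complex ^ 'n \<Rightarrow> complex"
  shows "f differentiable (at q within M) \<Longrightarrow> g differentiable (at q within M) \<Longrightarrow>
    (\<lambda>x. f x * g x) differentiable (at q within M)"
  unfolding differentiable_def using bounded_bilinear.FDERIV[OF bounded_bilinear_mult] by blast

private lemma cscale_diff:
  fixes Y :: "complex ^ 'n \<Rightarrow> (complex ^ 'n) complexified"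
  shows "f differentiable (at q within M) \<Longrightarrow> Y differentiable (at q within M) \<Longrightarrow>
    (\<lambda>x. cscale (f x) (Y x)) differentiable (at q within M)"
  unfolding differentiable_def using bounded_bilinear.FDERIV[OF bounded_bilinear_cscale] by blast

text \<open>The derivative of the C^2 function a along a C^1 field is C^1, so b can be
  differentiated once.\<close>

private lemma b_diff:
  assumes "q \<in> V"
  shows "coefficient_b differentiable (at q within M)"
proof -
  have L: "reg_on_subset (Ck 1) (\<lambda>q. cconj (L\<^sub>1 q)) V"
    by (rule reg_on_subset_Ck[OF reg_on_subset_generator_cconj[OF ctx]])
      (use r in \<open>auto intro!: regularity_ge_drop intro: regularity_ge_le\<close>)
  have "reg_on_subset (drop_reg (Ck 2) 1) (\<lambda>q. scalar_derivative M a q (cconj (L\<^sub>1 q))) V"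
    using L by (intro reg_on_subset_scalar_derivative[OF a openin_V] generator_cconj_in_ctangent[OF ctx])
      (simp_all add: regularity_ge_def)
  then have "(\<lambda>q. scalar_derivative M a q (cconj (L\<^sub>1 q))) differentiable (at q within M)"
    using reg_on_subset_differentiable[OF _ openin_V assms, of "Ck 1"] by (simp add: regularity_ge_def)
  then show ?thesis
    unfolding coefficient_b_def[abs_def]
    by (intro mult_diff cnj_diff a_diff[OF assms] differentiable_const)
qed

text \<open>The term along the conjugate field comes from a L(cnj a). As L(cnj a) is the conjugate
  of L'(a), its coefficient is exactly the conjugate of b, the shape of the third row of the
  group.\<close>

lemma field_T_change:
  assumes "q \<in> V"
  shows "field_T M L\<^sub>2 q = cscale (a q * cnj (a q)) (field_T M L\<^sub>1 q) +
    cscale (coefficient_b q) (L\<^sub>1 q) + cscale (cnj (coefficient_b q)) (cconj (L\<^sub>1 q))"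
proof -
  note q = in_M[OF assms] and sub = generator_subspace[OF ctx assms]
    and tan = local_generatorD(4)[OF L1 assms] generator_cconj_in_ctangent[OF ctx assms]
    and diff = generator_differentiable[OF ctx assms]
  have "lie_bracket M L\<^sub>2 (\<lambda>q. cconj (L\<^sub>2 q)) q =
      lie_bracket M (\<lambda>q. cscale (a q) (L\<^sub>1 q)) (\<lambda>q. cscale (cnj (a q)) (cconj (L\<^sub>1 q))) q"
    by (rule lie_bracket_cong[OF openin_V assms]) (simp_all add: L2_eq cconj_cscale)
  also have "\<dots> = cscale (a q * cnj (a q)) (lie_bracket M L\<^sub>1 (\<lambda>q. cconj (L\<^sub>1 q)) q) +
      cscale (a q * scalar_derivative M (\<lambda>q. cnj (a q)) q (L\<^sub>1 q)) (cconj (L\<^sub>1 q)) -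
      cscale (cnj (a q) * scalar_derivative M a q (cconj (L\<^sub>1 q))) (L\<^sub>1 q)"
    by (rule lie_bracket_cscale[OF q a_diff[OF assms] cnj_diff[OF a_diff[OF assms]] diff tan sub])
  also have "scalar_derivative M (\<lambda>q. cnj (a q)) q (L\<^sub>1 q) = cnj (scalar_derivative M a q (cconj (L\<^sub>1 q)))"
    using scalar_derivative_cnj[OF q a_diff[OF assms] tan(2) sub] by simp
  finally show ?thesis
    unfolding field_T_def
    by (simp add: coefficient_b_def cplx.scale_right_distrib cplx.scale_right_diff_distrib mult_ac)
qed

text \<open>By additivity the bracket of a L with T_2 is computed separately on the three terms of
  \<open>field_T_change\<close>. Existence of c, d, e at the point suffices, because the group
  leaves them free.\<close>

lemma field_S_change:
  assumes "p \<in> V"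
  obtains c d e where "field_S M L\<^sub>2 p = cscale (a p * a p * cnj (a p)) (field_S M L\<^sub>1 p) +
    cscale c (field_T M L\<^sub>1 p) + cscale d (cconj (L\<^sub>1 p)) + cscale e (L\<^sub>1 p)"
proof -
  note p = in_M[OF assms] and sub = generator_subspace[OF ctx assms]
    and tan = local_generatorD(4)[OF L1 assms] generator_cconj_in_ctangent[OF ctx assms]
      field_T_in_ctangent[OF ctx assms]
    and diff = generator_differentiable[OF ctx assms] field_T_differentiable[OF ctx assms]
    and a' = a_diff[OF assms] and b' = b_diff[OF assms] and cnj_b' = cnj_diff[OF b_diff[OF assms]]
  note m' = mult_diff[OF a' cnj_diff[OF a']]
  let ?X = "\<lambda>q. cscale (a q) (L\<^sub>1 q)" and ?m = "\<lambda>q. a q * cnj (a q)" and ?b = coefficient_b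
  let ?T = "\<lambda>q. cscale (?m q) (field_T M L\<^sub>1 q)" and ?bL = "\<lambda>q. cscale (?b q) (L\<^sub>1 q)"
    and ?bL' = "\<lambda>q. cscale (cnj (?b q)) (cconj (L\<^sub>1 q))"
  have X: "?X differentiable (at p within M)" "?X p \<in> ctangent M p"
    and T: "?T differentiable (at p within M)" "?T p \<in> ctangent M p"
    and bL: "?bL differentiable (at p within M)" "?bL p \<in> ctangent M p"
    and bL': "?bL' differentiable (at p within M)" "?bL' p \<in> ctangent M p"
    by (intro cscale_diff cscale_in_ctangent sub tan diff a' b' cnj_b' m')+
  have TbL: "(\<lambda>q. ?T q + ?bL q) differentiable (at p within M)" "?T p + ?bL p \<in> ctangent M p"
    using T bL sub by (auto intro: differentiable_add add_in_ctangent)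
  have "field_S M L\<^sub>2 p = lie_bracket M ?X (\<lambda>q. ?T q + ?bL q + ?bL' q) p"
    unfolding field_S_def by (rule lie_bracket_cong[OF openin_V assms]) (simp_all add: L2_eq field_T_change)
  also have "\<dots> = lie_bracket M ?X ?T p + lie_bracket M ?X ?bL p + lie_bracket M ?X ?bL' p"
    by (simp only: lie_bracket_add_right[OF p TbL(1) bL'(1) X(1,2) TbL(2) bL'(2) sub]
        lie_bracket_add_right[OF p T(1) bL(1) X(1,2) T(2) bL(2) sub])
  also have "lie_bracket M ?X ?T p = cscale (a p * ?m p) (field_S M L\<^sub>1 p) +
      cscale (a p * scalar_derivative M ?m p (L\<^sub>1 p)) (field_T M L\<^sub>1 p) -
      cscale (?m p * scalar_derivative M a p (field_T M L\<^sub>1 p)) (L\<^sub>1 p)"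
    unfolding field_S_def
    by (rule lie_bracket_cscale[OF p a' m' diff(1,3) tan(1,3) sub])
  also have "lie_bracket M ?X ?bL p = cscale (a p * scalar_derivative M ?b p (L\<^sub>1 p)) (L\<^sub>1 p) -
      cscale (?b p * scalar_derivative M a p (L\<^sub>1 p)) (L\<^sub>1 p)"
    using lie_bracket_cscale[OF p a' b' diff(1,1) tan(1,1) sub] by (simp add: lie_bracket_self)
  also have "lie_bracket M ?X ?bL' p = cscale (a p * cnj (?b p)) (cscale (- \<i>) (field_T M L\<^sub>1 p)) +
      cscale (a p * scalar_derivative M (\<lambda>q. cnj (?b q)) p (L\<^sub>1 p)) (cconj (L\<^sub>1 p)) -
      cscale (cnj (?b p) * scalar_derivative M a p (cconj (L\<^sub>1 p))) (L\<^sub>1 p)"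
    using lie_bracket_cscale[OF p a' cnj_b' diff(1,2) tan(1,2) sub] by (simp add: field_T_def)
  finally have "field_S M L\<^sub>2 p = cscale (a p * a p * cnj (a p)) (field_S M L\<^sub>1 p) +
    cscale (a p * scalar_derivative M ?m p (L\<^sub>1 p) - \<i> * a p * cnj (?b p)) (field_T M L\<^sub>1 p) +
    cscale (a p * scalar_derivative M (\<lambda>q. cnj (?b q)) p (L\<^sub>1 p)) (cconj (L\<^sub>1 p)) +
    cscale (- ?m p * scalar_derivative M a p (field_T M L\<^sub>1 p) + a p * scalar_derivative M ?b p (L\<^sub>1 p)
      - ?b p * scalar_derivative M a p (L\<^sub>1 p) - cnj (?b p) * scalar_derivative M a p (cconj (L\<^sub>1 p))) (L\<^sub>1 p)"
    by (simp add: cplx.scale_left_distrib cplx.scale_left_diff_distrib cscale_minus_left mult_ac)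
  then show ?thesis by (rule that)
qed

end

lemma associated_frames_related:
  fixes M :: "(complex ^ 4) set"
  assumes M: "embedded_submanifold r 5 M" and r: "regularity_ge r 3" and CR: "CR_generic M"
    and L1: "local_generator r M V L\<^sub>1" and L2: "local_generator r M V L\<^sub>2" and p: "p \<in> V"
  shows "\<exists>A\<in>G_III1_initial. associated_frame M L\<^sub>2 p = frame_action A (associated_frame M L\<^sub>1 p)"
proof -
  note D1 = local_generatorD[OF L1] and D2 = local_generatorD[OF L2]
  define a where "a q = cscale_coefficient (L\<^sub>2 q) (L\<^sub>1 q)" for q
  have a_eq: "L\<^sub>2 q = cscale (a q) (L\<^sub>1 q)" if q: "q \<in> V" for q
  proof -
    have qM: "q \<in> M" using q openin_imp_subset[OF D1(1)] by blast
    have "regularity_ge r 1" using regularity_ge_le[OF r] by simp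
    note tan = subspace_tangent_space[OF M qM this] dim_tangent_space[OF M qM this]
    obtain z where "L\<^sub>2 q = cscale z (L\<^sub>1 q)"
      using T10_line[OF tan _ D1(3)[OF q] D1(5)[OF q] D2(3)[OF q]] CR qM unfolding CR_generic_def by blast
    then show ?thesis by (simp add: a_def cscale_coefficient_cscale[OF D1(5)[OF q]])
  qed
  \<comment> \<open>Generators of a C^3 submanifold are at least C^2, and their Hermitian quotient a
    is then C^2 as well.\<close>
  have "regularity_ge (drop_reg r 1) 2" using regularity_ge_drop[of r 2 1] r by simp
  then have "reg_on_subset (Ck 2) a V"
    unfolding a_def[abs_def]
    by (intro reg_on_subset_cscale_coefficient reg_on_subset_Ck[OF D1(2)] reg_on_subset_Ck[OF D2(2)] D1(5))
  note ctx = M r L1 L2 this a_eq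
  obtain c d e where S: "field_S M L\<^sub>2 p = cscale (a p * a p * cnj (a p)) (field_S M L\<^sub>1 p) +
    cscale c (field_T M L\<^sub>1 p) + cscale d (cconj (L\<^sub>1 p)) + cscale e (L\<^sub>1 p)"
    using field_S_change[OF ctx p] by blast
  have "a p \<noteq> 0" using a_eq[OF p] D2(5)[OF p] by auto
  then have "G_mat (a p) (coefficient_b M L\<^sub>1 a p) c d e \<in> G_III1_initial"
    unfolding G_III1_initial_eq by blast
  moreover have "associated_frame M L\<^sub>2 p =
      frame_action (G_mat (a p) (coefficient_b M L\<^sub>1 a p) c d e) (associated_frame M L\<^sub>1 p)"
    unfolding associated_frame_def
    by (rule frame_change_matrix[OF a_eq[OF p] field_T_change[OF ctx p] S cconj_field_T[OF M r L1 p]])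
  ultimately show ?thesis by blast
qed

theorem mainTheorem3:
  fixes M :: "(complex ^ 4) set" and r :: regularity
  assumes "\<And>\<kappa>. r = Ck \<kappa> \<Longrightarrow> \<kappa> \<ge> 3"
    and "embedded_submanifold r 5 M"
    and "connected M"
    and "CR_generic M"
    and "class_III1 r M"
  shows "(\<forall>V L. local_generator r M V L \<longrightarrow>
            local_frame (drop_reg r 3) (ctangent M) V (associated_frame M L) \<and>
            (\<forall>p\<in>V. cconj (field_S M L p) = lie_bracket M (\<lambda>q. cconj (L q)) (field_T M L) p))
       \<and> associated_frames_reduce_to r M G_III1_initial
       \<and> embedded_submanifold Cinf 10 G_III1_initial"
proof (intro conjI allI impI ballI)
  have r: "regularity_ge r 3" using assms(1) by (simp add: regularity_ge_def)
  fix V L assume L: "local_generator r M V L"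
  show "local_frame (drop_reg r 3) (ctangent M) V (associated_frame M L)"
    by (rule associated_frame_local_frame[OF assms(2) r L assms(5)])
  show "cconj (field_S M L p) = lie_bracket M (\<lambda>q. cconj (L q)) (field_T M L) p" if "p \<in> V" for p
    by (rule cconj_field_S[OF assms(2) r L that])
next
  have r: "regularity_ge r 3" using assms(1) by (simp add: regularity_ge_def)
  show "associated_frames_reduce_to r M G_III1_initial"
    unfolding associated_frames_reduce_to_def
    using subgroup_G_III1_initial closedin_G_III1_initial associated_frames_related[OF assms(2) r assms(4)]
    by blast
qed (rule embedded_submanifold_G_III1_initial)

end
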